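(* Assume the Gram matrix $\mathcal{G}=(\langle\eta_i,\eta_j\rangle_W)_{i,j=1}^{N_m}$ of the Riesz representers $\eta_1,\dots,\eta_{N_m}$ of the operator $\mathbf{K}:W\to\mathbb{R}^{N_m}$ is positive definite, and let $\mathcal{G}=U\Lambda U^T$ be its spectral factorization, with $\Lambda=\mathrm{diag}(\lambda_1,\dots,\lambda_{N_m})$, $\lambda_1\ge\dots\ge\lambda_{N_m}>0$, and $U=[\mathbf{u}_1,\dots,\mathbf{u}_{N_m}]$ orthogonal. Let $u_{j\ell}$ denote the $j$th component of the eigenvector $\mathbf{u}_\ell$. Then the minimal-norm solution $f^\dagger$ of $\mathbf{K}f=\mathbf{g}$, $f(a)=f(b)=0$, can be written as a linear combination of orthonormal functions $\widehat{\eta}_\ell$ in $W$, $$f^\dagger=\sum_{\ell=1}^{N_m}\widehat{c}_\ell\,\widehat{\eta}_\ell,$$ where $$\widehat{c}_\ell=\frac{\mathbf{u}_\ell^T\mathbf{g}}{\sqrt{\lambda_\ell}},\qquad \widehat{\eta}_\ell=\sum_{j=1}^{N_m}\frac{u_{j\ell}}{\sqrt{\lambda_\ell}}\,\eta_j,\qquad \ell=1,\dots,N_m.$$ Moreover, the set of triplets $\{\sqrt{\lambda_\ell},\widehat{\eta}_\ell,\mathbf{u}_\ell\}$, $\ell=1,\dots,N_m$, is the singular system of the operator $\mathbf{K}$.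
   Context: Let $a<b$ be real. $W$ is the real Hilbert space $W=\{f\in L^2([a,b]) : f(a)=f(b)=0,\ f,f'\in AC([a,b]),\ f''\in L^2([a,b])\}$, where $AC([a,b])$ denotes the absolutely continuous functions on $[a,b]$, with inner product $\langle f,g\rangle_W=\int_a^b f''(x)g''(x)\,dx$ and norm $\|f\|_W=\|f''\|_{L^2}$. Let $m\ge1$, $n_1,\dots,n_m\ge 1$, $N_0=0$ and $N_r=\sum_{k=1}^r n_k$. For $r=1,\dots,m$ let $k_r:[c_r,d_r]\times[a,b]\to\mathbb{R}$ be a kernel, let $x_{r,1},\dots,x_{r,n_r}\in[c_r,d_r]$ be given points, and put $(K_r f)(x)=\int_a^b k_r(x,t)f(t)\,dt$. The operator $\mathbf{K}:W\to\mathbb{R}^{N_m}$ is defined by $(\mathbf{K}f)_j=(K_r f)(x_{r,i})$ for $j=i+N_{r-1}$, $r=1,\dots,m$, $i=1,\dots,n_r$. It is a standing assumption that $\mathbf{K}$ is a well-defined bounded linear operator on $W$. The data vector is $\mathbf{g}\in\mathbb{R}^{N_m}$ with components $\mathbf{g}_{i+N_{r-1}}=g_r(x_{r,i})$, where the $g_r:[c_r,d_r]\to\mathbb{R}$ are given. Riesz representers: $\eta_1,\dots,\eta_{N_m}\in W$ are the unique functions with $(\mathbf{K}f)_j=\langle\eta_j,f\rangle_W$ for all $f\in W$, $j=1,\dots,N_m$. Minimal-norm solution: $f^\dagger$ is the unique element of smallest norm $\|\cdot\|_W$ among all minimizers over $f\in W$ of $\|\mathbf{K}f-\mathbf{g}\|_2^2$,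 where $\|\cdot\|_2$ is the Euclidean norm (the problem $\mathbf{K}f=\mathbf{g}$ is understood in this least-squares sense). Adjoint: $\mathbf{K}^*:\mathbb{R}^{N_m}\to W$ is defined by $\langle\mathbf{K}f,\mathbf{h}\rangle_2=\langle f,\mathbf{K}^*\mathbf{h}\rangle_W$ for all $f\in W$, $\mathbf{h}\in\mathbb{R}^{N_m}$. Singular system: a family of triplets $\{\sigma_\ell,v_\ell,\mathbf{w}_\ell\}$ with $\sigma_\ell>0$ in non-increasing order is a singular system of $\mathbf{K}$ if the $v_\ell$ form an orthonormal basis of $\mathcal{N}(\mathbf{K})^\perp$ (orthogonal complement of the null space in $W$), the $\mathbf{w}_\ell$ form an orthonormal basis of the range of $\mathbf{K}$ in $\mathbb{R}^{N_m}$, and $\mathbf{K}v_\ell=\sigma_\ell\mathbf{w}_\ell$, $\mathbf{K}^*\mathbf{w}_\ell=\sigma_\ell v_\ell$ for all $\ell$ (hence $\mathbf{K}^*\mathbf{K}v_\ell=\sigma_\ell^2v_\ell$ and $\mathbf{K}\mathbf{K}^*\mathbf{w}_\ell=\sigma_\ell^2\mathbf{w}_\ell$). *)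

theory Defs
  imports "HOL-Analysis.Analysis" "Jordan_Normal_Form.Matrix"
begin

text \<open>\<open>$\<close> and \<open>\<bullet>\<close> below are the operations on the vectors of
  Jordan_Normal_Form; \<open>\<^sup>T\<close> is its matrix transpose.\<close>
unbundle no vec_syntax
unbundle no inner_syntax

section \<open>The space W\<close>

definition AC_on :: "real \<Rightarrow> real \<Rightarrow> (real \<Rightarrow> real) \<Rightarrow> bool" where
  "AC_on a b f \<longleftrightarrow>
    (\<forall>\<epsilon>>0. \<exists>\<delta>>0. \<forall>I :: (real \<times> real) set.
       finite I \<and>
       (\<forall>(u, v) \<in> I. a \<le> u \<and> u \<le> v \<and> v \<le> b) \<and>
       pairwise (\<lambda>p q. disjnt {fst p<..<snd p} {fst q<..<snd q}) I \<and>
       (\<Sum>(u, v)\<in>I. v - u) < \<delta>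
       \<longrightarrow> (\<Sum>(u, v)\<in>I. \<bar>f v - f u\<bar>) < \<epsilon>)"

definition L2_on :: "real \<Rightarrow> real \<Rightarrow> (real \<Rightarrow> real) \<Rightarrow> bool" where
  "L2_on a b f \<longleftrightarrow>
    set_borel_measurable lebesgue {a..b} f \<and>
    set_integrable lebesgue {a..b} (\<lambda>t. (f t)\<^sup>2)"

text \<open>The derivative on \<open>[a,b]\<close>, one-sided at the end points. Its value is unspecified at points
  where \<open>f\<close> is not differentiable; for the second derivative of an element of \<open>W\<close> these
  form a null set.\<close>
definition D1 :: "real \<Rightarrow> real \<Rightarrow> (real \<Rightarrow> real) \<Rightarrow> real \<Rightarrow> real" where
  "D1 a b f t = vector_derivative f (at t within {a..b})"

definition D2 :: "real \<Rightarrow> real \<Rightarrow> (real \<Rightarrow> real) \<Rightarrow> real \<Rightarrow> real" where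
  "D2 a b f = D1 a b (D1 a b f)"

text \<open>A function on \<open>[a,b]\<close> is represented by its extension by zero to the real line, so that
  equality of elements of \<open>W\<close> is equality of HOL functions. (An element of \<open>L\<^sup>2\<close> with an
  absolutely continuous representative has only one, and \<open>f' \<in> AC\<close> includes that \<open>f'\<close> exists
  on all of \<open>[a,b]\<close>.)\<close>
definition W :: "real \<Rightarrow> real \<Rightarrow> (real \<Rightarrow> real) set" where
  "W a b = {f. (\<forall>t. t \<notin> {a..b} \<longrightarrow> f t = 0) \<and>
     L2_on a b f \<and> f a = 0 \<and> f b = 0 \<and>
     AC_on a b f \<and> f differentiable_on {a..b} \<and> AC_on a b (D1 a b f) \<and>
     L2_on a b (D2 a b f)}"

definition W_inner :: "real \<Rightarrow> real \<Rightarrow> (real \<Rightarrow> real) \<Rightarrow> (real \<Rightarrow> real) \<Rightarrow> real" where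
  "W_inner a b f h = (LINT t:{a..b}|lebesgue. D2 a b f t * D2 a b h t)"

definition W_norm :: "real \<Rightarrow> real \<Rightarrow> (real \<Rightarrow> real) \<Rightarrow> real" where
  "W_norm a b f = sqrt (W_inner a b f f)"

section \<open>Block vectors and the operator K\<close>

definition block_offset :: "(nat \<Rightarrow> nat) \<Rightarrow> nat \<Rightarrow> nat" where
  "block_offset n r = (\<Sum>k=1..r. n k)"

text \<open>The vector whose blocks are \<open>(y r 1, \<dots>, y r (n r))\<close> for \<open>r = 1, \<dots>, m\<close>. Vector and matrix
  indices start at 0, so the component with mathematical index \<open>j = i + N\<^sub>r\<^sub>-\<^sub>1\<close> is at position
  \<open>j - 1\<close>; see \<open>block_vec_index\<close>.\<close>
definition block_vec :: "nat \<Rightarrow> (nat \<Rightarrow> nat) \<Rightarrow> (nat \<Rightarrow> nat \<Rightarrow> real) \<Rightarrow> real vec" where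
  "block_vec m n y = vec_of_list (concat (map (\<lambda>r. map (y r) [1..<Suc (n r)]) [1..<Suc m]))"

lemma length_blocks:
  "length (concat (map (\<lambda>r. map (y r) [1..<Suc (n r)]) [1..<Suc m])) = block_offset n m"
proof (induction m)
  case 0
  then show ?case by (simp add: block_offset_def)
next
  case (Suc m)
  have "[1..<Suc (Suc m)] = [1..<Suc m] @ [Suc m]" by simp
  then show ?case
    using Suc by (simp add: block_offset_def del: upt_Suc One_nat_def)
qed

lemma block_vec_carrier: "block_vec m n y \<in> carrier_vec (block_offset n m)"
  unfolding block_vec_def carrier_vec_def by (simp add: length_blocks del: upt_Suc One_nat_def)

lemma block_vec_index:
  assumes "r \<in> {1..m}" "i \<in> {1..n r}"
  shows "block_vec m n y $ (i + block_offset n (r - 1) - 1) = y r i"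
proof -
  have "concat (map (\<lambda>r. map (y r) [1..<Suc (n r)]) [1..<Suc m])
          ! (i + block_offset n (r - 1) - 1) = y r i"
    using assms(1)
  proof (induction m)
    case 0
    then show ?case by simp
  next
    case (Suc m)
    let ?L = "\<lambda>m. concat (map (\<lambda>r. map (y r) [1..<Suc (n r)]) [1..<Suc m])"
    have L: "?L (Suc m) = ?L m @ map (y (Suc m)) [1..<Suc (n (Suc m))]"
      by simp
    show ?case
    proof (cases "r = Suc m")
      case True
      then have "\<not> i + block_offset n (r - 1) - 1 < length (?L m)"
        and "i + block_offset n (r - 1) - 1 - length (?L m) = i - 1" and "i - 1 < n (Suc m)"
        using assms(2) unfolding length_blocks by auto
      then show ?thesis
        using assms(2) True unfolding L nth_append by (simp del: upt_Suc)
    next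
      case False
      then have r: "r \<in> {1..m}" using Suc.prems by auto
      then have "block_offset n r \<le> block_offset n m"
        unfolding block_offset_def by (intro sum_mono2) auto
      moreover have "block_offset n r = block_offset n (r - 1) + n r"
        using r by (cases r) (auto simp: block_offset_def)
      ultimately have "i + block_offset n (r - 1) - 1 < length (?L m)"
        using assms(2) unfolding length_blocks by auto
      then show ?thesis
        using Suc.IH[OF r] unfolding L nth_append by simp
    qed
  qed
  then show ?thesis
    unfolding block_vec_def by (simp add: vec_of_list_index del: upt_Suc One_nat_def)
qed

definition kernel_int ::
  "real \<Rightarrow> real \<Rightarrow> (real \<Rightarrow> real \<Rightarrow> real) \<Rightarrow> (real \<Rightarrow> real) \<Rightarrow> real \<Rightarrow> real" where
  "kernel_int a b k f s = (LINT t:{a..b}|lebesgue. k s t * f t)"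

definition K_op ::
  "real \<Rightarrow> real \<Rightarrow> nat \<Rightarrow> (nat \<Rightarrow> nat) \<Rightarrow> (nat \<Rightarrow> real \<Rightarrow> real \<Rightarrow> real) \<Rightarrow> (nat \<Rightarrow> nat \<Rightarrow> real) \<Rightarrow>
   (real \<Rightarrow> real) \<Rightarrow> real vec" where
  "K_op a b m n k x f = block_vec m n (\<lambda>r i. kernel_int a b (k r) f (x r i))"

definition K_well_defined ::
  "real \<Rightarrow> real \<Rightarrow> nat \<Rightarrow> (nat \<Rightarrow> nat) \<Rightarrow> (nat \<Rightarrow> real \<Rightarrow> real \<Rightarrow> real) \<Rightarrow> (nat \<Rightarrow> nat \<Rightarrow> real) \<Rightarrow> bool" where
  "K_well_defined a b m n k x \<longleftrightarrow>
    (\<forall>f\<in>W a b. \<forall>r\<in>{1..m}. \<forall>i\<in>{1..n r}.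
       set_integrable lebesgue {a..b} (\<lambda>t. k r (x r i) t * f t))"

definition vec_norm2 :: "real vec \<Rightarrow> real" where
  "vec_norm2 v = sqrt (v \<bullet> v)"

definition bounded_linear_on_W :: "real \<Rightarrow> real \<Rightarrow> ((real \<Rightarrow> real) \<Rightarrow> real vec) \<Rightarrow> bool" where
  "bounded_linear_on_W a b K \<longleftrightarrow>
    (\<forall>f\<in>W a b. \<forall>h\<in>W a b. \<forall>\<alpha> \<beta>.
       K (\<lambda>t. \<alpha> * f t + \<beta> * h t) = \<alpha> \<cdot>\<^sub>v K f + \<beta> \<cdot>\<^sub>v K h) \<and>
    (\<exists>C. \<forall>f\<in>W a b. vec_norm2 (K f) \<le> C * W_norm a b f)"

section \<open>Riesz representers, minimal-norm solution, adjoint, singular system\<close>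

definition riesz_representers ::
  "real \<Rightarrow> real \<Rightarrow> nat \<Rightarrow> ((real \<Rightarrow> real) \<Rightarrow> real vec) \<Rightarrow> (nat \<Rightarrow> real \<Rightarrow> real) \<Rightarrow> bool" where
  "riesz_representers a b N K \<eta> \<longleftrightarrow>
    (\<forall>j<N. \<eta> j \<in> W a b \<and> (\<forall>f\<in>W a b. K f $ j = W_inner a b (\<eta> j) f))"

definition gram_matrix :: "real \<Rightarrow> real \<Rightarrow> nat \<Rightarrow> (nat \<Rightarrow> real \<Rightarrow> real) \<Rightarrow> real mat" where
  "gram_matrix a b N \<eta> = Matrix.mat N N (\<lambda>(i, j). W_inner a b (\<eta> i) (\<eta> j))"

definition positive_definite :: "nat \<Rightarrow> real mat \<Rightarrow> bool" where
  "positive_definite N A \<longleftrightarrow>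
    A \<in> carrier_mat N N \<and> A\<^sup>T = A \<and>
    (\<forall>v\<in>carrier_vec N. v \<noteq> 0\<^sub>v N \<longrightarrow> v \<bullet> (A *\<^sub>v v) > 0)"

text \<open>\<open>orthogonal_mat\<close> of Jordan_Normal_Form does not require the columns to have norm 1.\<close>
definition spectral_factorization ::
  "nat \<Rightarrow> real mat \<Rightarrow> real mat \<Rightarrow> (nat \<Rightarrow> real) \<Rightarrow> bool" where
  "spectral_factorization N A U lam \<longleftrightarrow>
    U \<in> carrier_mat N N \<and> U\<^sup>T * U = 1\<^sub>m N \<and> U * U\<^sup>T = 1\<^sub>m N \<and>
    A = U * mat_diag N lam * U\<^sup>T \<and>
    (\<forall>i j. i \<le> j \<and> j < N \<longrightarrow> lam j \<le> lam i)"

definition least_squares_minimizer ::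
  "real \<Rightarrow> real \<Rightarrow> ((real \<Rightarrow> real) \<Rightarrow> real vec) \<Rightarrow> real vec \<Rightarrow> (real \<Rightarrow> real) \<Rightarrow> bool" where
  "least_squares_minimizer a b K y f \<longleftrightarrow>
    f \<in> W a b \<and> (\<forall>h\<in>W a b. (vec_norm2 (K f - y))\<^sup>2 \<le> (vec_norm2 (K h - y))\<^sup>2)"

definition is_minimal_norm_solution ::
  "real \<Rightarrow> real \<Rightarrow> ((real \<Rightarrow> real) \<Rightarrow> real vec) \<Rightarrow> real vec \<Rightarrow> (real \<Rightarrow> real) \<Rightarrow> bool" where
  "is_minimal_norm_solution a b K y f \<longleftrightarrow>
    least_squares_minimizer a b K y f \<and>
    (\<forall>h. least_squares_minimizer a b K y h \<longrightarrow> W_norm a b f \<le> W_norm a b h)"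

definition minimal_norm_solution ::
  "real \<Rightarrow> real \<Rightarrow> ((real \<Rightarrow> real) \<Rightarrow> real vec) \<Rightarrow> real vec \<Rightarrow> real \<Rightarrow> real" where
  "minimal_norm_solution a b K y = (THE f. is_minimal_norm_solution a b K y f)"

definition adjoint_op ::
  "real \<Rightarrow> real \<Rightarrow> ((real \<Rightarrow> real) \<Rightarrow> real vec) \<Rightarrow> real vec \<Rightarrow> real \<Rightarrow> real" where
  "adjoint_op a b K h = (THE u. u \<in> W a b \<and> (\<forall>f\<in>W a b. K f \<bullet> h = W_inner a b f u))"

definition null_space_perp ::
  "real \<Rightarrow> real \<Rightarrow> nat \<Rightarrow> ((real \<Rightarrow> real) \<Rightarrow> real vec) \<Rightarrow> (real \<Rightarrow> real) set" where
  "null_space_perp a b N K =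
    {f \<in> W a b. \<forall>h\<in>W a b. K h = 0\<^sub>v N \<longrightarrow> W_inner a b f h = 0}"

definition orthonormal_W :: "real \<Rightarrow> real \<Rightarrow> nat \<Rightarrow> (nat \<Rightarrow> real \<Rightarrow> real) \<Rightarrow> bool" where
  "orthonormal_W a b L v \<longleftrightarrow>
    (\<forall>l<L. v l \<in> W a b) \<and>
    (\<forall>k<L. \<forall>l<L. W_inner a b (v k) (v l) = (if k = l then 1 else 0))"

text \<open>The families are finite, so an orthonormal basis is an orthonormal family in the subspace
  of which every element of the subspace is a linear combination.\<close>
definition orthonormal_basis_W ::
  "real \<Rightarrow> real \<Rightarrow> nat \<Rightarrow> (nat \<Rightarrow> real \<Rightarrow> real) \<Rightarrow> (real \<Rightarrow> real) set \<Rightarrow> bool" where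
  "orthonormal_basis_W a b L v S \<longleftrightarrow>
    (\<forall>l<L. v l \<in> S) \<and> orthonormal_W a b L v \<and>
    (\<forall>f\<in>S. \<exists>c :: nat \<Rightarrow> real. f = (\<lambda>t. \<Sum>l<L. c l * v l t))"

definition orthonormal_basis_vec ::
  "nat \<Rightarrow> nat \<Rightarrow> (nat \<Rightarrow> real vec) \<Rightarrow> real vec set \<Rightarrow> bool" where
  "orthonormal_basis_vec N L w S \<longleftrightarrow>
    (\<forall>l<L. w l \<in> carrier_vec N \<and> w l \<in> S) \<and>
    (\<forall>k<L. \<forall>l<L. w k \<bullet> w l = (if k = l then 1 else 0)) \<and>
    (\<forall>y\<in>S. \<exists>c :: nat \<Rightarrow> real. y = Matrix.vec N (\<lambda>j. \<Sum>l<L. c l * w l $ j))"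

definition singular_system ::
  "real \<Rightarrow> real \<Rightarrow> nat \<Rightarrow> ((real \<Rightarrow> real) \<Rightarrow> real vec) \<Rightarrow>
   nat \<Rightarrow> (nat \<Rightarrow> real) \<Rightarrow> (nat \<Rightarrow> real \<Rightarrow> real) \<Rightarrow> (nat \<Rightarrow> real vec) \<Rightarrow> bool" where
  "singular_system a b N K L \<sigma> v w \<longleftrightarrow>
    (\<forall>l<L. \<sigma> l > 0) \<and> (\<forall>k l. k \<le> l \<and> l < L \<longrightarrow> \<sigma> l \<le> \<sigma> k) \<and>
    orthonormal_basis_W a b L v (null_space_perp a b N K) \<and>
    orthonormal_basis_vec N L w (K ` W a b) \<and>
    (\<forall>l<L. K (v l) = \<sigma> l \<cdot>\<^sub>v w l) \<and>
    (\<forall>l<L. adjoint_op a b K (w l) = (\<lambda>t. \<sigma> l * v l t))"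

end

theory Submission
  imports Defs
begin

text \<open>By the Riesz property, \<open>\<langle>\<eta>\<^sub>j, f\<rangle>\<close> is the \<open>j\<close>th entry of \<open>K f\<close>, so the Gram matrix is \<open>K K\<^sup>*\<close> and its
  spectral factorization yields the singular value decomposition of \<open>K\<close>: with
  \<open>v\<^sub>\<ell> = K\<^sup>* u\<^sub>\<ell> / \<surd>\<lambda>\<^sub>\<ell>\<close> one gets \<open>\<langle>v\<^sub>\<ell>, f\<rangle> = (u\<^sub>\<ell> \<bullet> K f) / \<surd>\<lambda>\<^sub>\<ell>\<close> and \<open>K v\<^sub>\<ell> = \<surd>\<lambda>\<^sub>\<ell> u\<^sub>\<ell>\<close>. As \<open>K\<close> is onto, the
  least-squares minimizers are the solutions of \<open>K f = g\<close>; they differ by elements of the null space,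
  which is orthogonal to every \<open>v\<^sub>\<ell>\<close>, and Pythagoras selects the one in the span of the \<open>v\<^sub>\<ell>\<close>.

  The analytic content is that \<open>W\<close> is an inner product space. Since \<open>D2\<close> is a pointwise derivative,
  its linearity almost everywhere needs Lebesgue's theorem that an absolutely continuous function is
  differentiable almost everywhere, and definiteness needs that an absolutely continuous function
  with derivative zero almost everywhere is constant. Both follow from Vitali coverings by intervals
  on which the slope of the function is controlled: absolute continuity makes the increments over
  the uncovered rest negligible.\<close>

section \<open>Divisions, Vitali coverings and absolute continuity\<close>

text \<open>A division is a set of intervals rather than of endpoint pairs, so the increment has to
  be a function of the interval itself. \<open>Inf\<close> and \<open>Sup\<close> recover the
  endpoints.\<close>

definition increment :: "(real \<Rightarrow> real) \<Rightarrow> real set \<Rightarrow> real" where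
  "increment f k = f (Sup k) - f (Inf k)"

lemma increment_atLeastAtMost [simp]: "u \<le> v \<Longrightarrow> increment f {u..v} = f v - f u"
  by (simp add: increment_def)

lemma division_of_realE:
  fixes S :: "real set"
  assumes "D division_of S" "k \<in> D"
  obtains u v where "u \<le> v" "k = {u..v}"
  using division_ofD(3,4)[OF assms] by (metis atLeastatMost_empty_iff box_real(2))

text \<open>Translates \<open>AC_on\<close> into the language of divisions. Members of a division
  have disjoint interiors, which is the disjointness \<open>AC_on\<close> asks for, and their
  lengths add up to the measure of the divided set.\<close>

lemma AC_on_divisionE:
  assumes "AC_on a b f" "\<epsilon> > 0"
  obtains \<delta> where "\<delta> > 0"
    "\<And>D S. \<lbrakk>D division_of S; S \<subseteq> {a..b}; measure lebesgue S < \<delta>\<rbrakk>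
       \<Longrightarrow> (\<Sum>k\<in>D. \<bar>increment f k\<bar>) < \<epsilon>"
proof -
  from assms obtain \<delta> where "\<delta> > 0" and \<delta>: "\<And>I :: (real \<times> real) set.
       finite I \<Longrightarrow> (\<forall>(u, v) \<in> I. a \<le> u \<and> u \<le> v \<and> v \<le> b) \<Longrightarrow>
       pairwise (\<lambda>p q. disjnt {fst p<..<snd p} {fst q<..<snd q}) I \<Longrightarrow>
       (\<Sum>(u, v)\<in>I. v - u) < \<delta> \<Longrightarrow> (\<Sum>(u, v)\<in>I. \<bar>f v - f u\<bar>) < \<epsilon>"
    unfolding AC_on_def by meson
  show thesis
  proof (rule that[OF \<open>\<delta> > 0\<close>])
    fix D and S :: "real set"
    assume D: "D division_of S" and S: "S \<subseteq> {a..b}" "measure lebesgue S < \<delta>"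
    let ?e = "\<lambda>k :: real set. (Inf k, Sup k)"
    have ends: "Inf k \<le> Sup k" "k = {Inf k..Sup k}" if "k \<in> D" for k
      using division_of_realE[OF D that] by (metis cInf_atLeastAtMost cSup_atLeastAtMost)+
    have inj: "inj_on ?e D"
      by (rule inj_on_inverseI[where g = "\<lambda>p. {fst p..snd p}"]) (use ends(2) in simp)
    have int: "interior k = {Inf k<..<Sup k}" if "k \<in> D" for k
      by (subst ends(2)[OF that], rule interior_atLeastAtMost_real)
    have "(\<Sum>(u, v)\<in>?e ` D. \<bar>f v - f u\<bar>) < \<epsilon>"
    proof (rule \<delta>)
      show "finite (?e ` D)" using D by blast
      show "\<forall>(u, v) \<in> ?e ` D. a \<le> u \<and> u \<le> v \<and> v \<le> b"
      proof clarify
        fix k assume k: "k \<in> D"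
        then have "{Inf k..Sup k} \<subseteq> {a..b}"
          using division_ofD(2)[OF D k] ends(2)[OF k] S(1) by auto
        then show "a \<le> Inf k \<and> Inf k \<le> Sup k \<and> Sup k \<le> b"
          using ends(1)[OF k] by auto
      qed
      show "pairwise (\<lambda>p q. disjnt {fst p<..<snd p} {fst q<..<snd q}) (?e ` D)"
      proof (rule pairwiseI)
        fix p q assume "p \<in> ?e ` D" "q \<in> ?e ` D" "p \<noteq> q"
        then obtain k l where kl: "k \<in> D" "l \<in> D" "k \<noteq> l" "p = ?e k" "q = ?e l" by blast
        show "disjnt {fst p<..<snd p} {fst q<..<snd q}"
          using division_ofD(5)[OF D kl(1-3)] unfolding int[OF kl(1)] int[OF kl(2)] kl(4,5)
          by (simp add: disjnt_def)
      qed
      have "(\<Sum>(u, v)\<in>?e ` D. v - u) = (\<Sum>k\<in>D. Sup k - Inf k)"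
        by (simp add: sum.reindex[OF inj])
      also have "\<dots> = (\<Sum>k\<in>D. measure lebesgue k)"
        by (intro sum.cong refl) (metis ends measure_lborel_Icc measure_completion borel_closed closed_atLeastAtMost sets_lborel)
      also have "\<dots> < \<delta>"
        using content_division[OF D] S(2) by simp
      finally show "(\<Sum>(u, v)\<in>?e ` D. v - u) < \<delta>" .
    qed
    then show "(\<Sum>k\<in>D. \<bar>increment f k\<bar>) < \<epsilon>"
      by (simp add: sum.reindex[OF inj] increment_def)
  qed
qed

text \<open>The sum telescopes. Telescoping is available for tagged divisions, so each interval is
  tagged with its left endpoint.\<close>

lemma sum_increment_division:
  assumes "u \<le> v" and D: "D division_of {u..v}"
  shows "(\<Sum>k\<in>D. increment f k) = f v - f u"
proof -
  let ?t = "\<lambda>k :: real set. (Inf k, k)"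
  have "?t ` D tagged_division_of {u..v}"
  proof (rule tagged_division_ofI)
    show "finite (?t ` D)" using D by blast
  next
    fix x k assume "(x, k) \<in> ?t ` D"
    then have k: "k \<in> D" "x = Inf k" by auto
    obtain s t where "s \<le> t" "k = {s..t}" using division_of_realE[OF D k(1)] .
    then show "x \<in> k" "\<exists>a b. k = cbox a b" using k(2) by auto
    show "k \<subseteq> {u..v}" using division_ofD(2)[OF D k(1)] .
  next
    fix x k y l assume "(x, k) \<in> ?t ` D" "(y, l) \<in> ?t ` D" "(x, k) \<noteq> (y, l)"
    then show "interior k \<inter> interior l = {}" using division_ofD(5)[OF D] by blast
  next
    have "{k. \<exists>x. (x, k) \<in> ?t ` D} = D" by auto
    then show "\<Union> {k. \<exists>x. (x, k) \<in> ?t ` D} = {u..v}" using division_ofD(6)[OF D] by simp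
  qed
  then have "(\<Sum>(x, k)\<in>?t ` D. f (Sup k) - f (Inf k)) = f v - f u"
    using additive_tagged_division_1[OF assms(1)] by blast
  then show ?thesis
    by (simp add: sum.reindex inj_on_def increment_def)
qed

text \<open>Inside each \<open>k\<close> of \<open>I\<close>, the members of \<open>J\<close>
  contained in \<open>k\<close> are completed to a division of \<open>k\<close>. Since
  \<open>I\<close> is disjoint, the completions do not interfere and together divide
  \<open>S\<close>; telescoping within each \<open>k\<close> preserves the total increment.\<close>

lemma division_refineE:
  fixes I J :: "real set set"
  assumes I: "I division_of S" and disj: "pairwise disjnt I"
    and J: "J division_of T" and sub: "\<And>j. j \<in> J \<Longrightarrow> \<exists>k\<in>I. j \<subseteq> k"
  obtains Q where "Q division_of S" "J \<subseteq> Q"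
    "\<And>f. (\<Sum>k\<in>Q. increment f k) = (\<Sum>k\<in>I. increment f k)"
proof -
  have "\<exists>q. {j\<in>J. j \<subseteq> k} \<subseteq> q \<and> q division_of k" if k: "k \<in> I" for k
  proof -
    obtain u v where uv: "u \<le> v" "k = {u..v}" using division_of_realE[OF I k] .
    have "{j\<in>J. j \<subseteq> k} division_of \<Union>{j\<in>J. j \<subseteq> k}"
      by (rule division_of_subset[OF J[folded division_ofD(6)[OF J]]]) 
         (use division_ofD(6)[OF J] J in auto)
    moreover have "\<Union>{j\<in>J. j \<subseteq> k} \<subseteq> cbox u v"
      using uv(2) by (simp add: Sup_le_iff)
    ultimately obtain q where "{j\<in>J. j \<subseteq> k} \<subseteq> q" "q division_of cbox u v"
      by (rule partial_division_extend_interval)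
    then show ?thesis
      using uv(2) by (intro exI[of _ q]) simp
  qed
  then obtain q where q: "\<And>k. k \<in> I \<Longrightarrow> {j\<in>J. j \<subseteq> k} \<subseteq> q k"
    and div: "\<And>k. k \<in> I \<Longrightarrow> q k division_of k"
    by metis
  have finI: "finite I" using I by blast
  have apart: "h \<inter> h' = {}" if "k \<in> I" "k' \<in> I" "k \<noteq> k'" "h \<in> q k" "h' \<in> q k'" for k k' h h'
    using that disj division_ofD(2)[OF div] unfolding pairwise_def disjnt_def by blast
  show thesis
  proof (rule that[of "\<Union> (q ` I)"])
    show "\<Union> (q ` I) division_of S"
    proof (rule division_ofI)
      show "finite (\<Union> (q ` I))" using finI div by blast
      have "\<Union> (\<Union> (q ` I)) = (\<Union>k\<in>I. \<Union> (q k))" by blast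
      also have "\<dots> = (\<Union>k\<in>I. k)" using division_ofD(6)[OF div] by (intro SUP_cong) auto
      finally show un: "\<Union> (\<Union> (q ` I)) = S" using division_ofD(6)[OF I] by simp
      show "h \<subseteq> S" if "h \<in> \<Union> (q ` I)" for h
        unfolding un[symmetric] using that by (rule Union_upper)
      show "h \<noteq> {}" if "h \<in> \<Union> (q ` I)" for h using division_ofD(3)[OF div] that by blast
      show "\<exists>a b. h = cbox a b" if "h \<in> \<Union> (q ` I)" for h
        using division_ofD(4)[OF div] that by blast
      fix h h' assume "h \<in> \<Union> (q ` I)" "h' \<in> \<Union> (q ` I)" "h \<noteq> h'"
      then obtain k k' where k: "k \<in> I" "h \<in> q k" "k' \<in> I" "h' \<in> q k'" by blast
      show "interior h \<inter> interior h' = {}"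
      proof (cases "k = k'")
        case True
        then show ?thesis using division_ofD(5)[OF div[OF k(1)]] k \<open>h \<noteq> h'\<close> by simp
      next
        case False
        then show ?thesis using apart[OF k(1,3) False k(2,4)] interior_subset by blast
      qed
    qed
    show "J \<subseteq> \<Union> (q ` I)" using sub q by blast
    show "(\<Sum>k\<in>\<Union> (q ` I). increment f k) = (\<Sum>k\<in>I. increment f k)" for f
    proof -
      have "(\<Sum>k\<in>\<Union> (q ` I). increment f k) = (\<Sum>k\<in>I. \<Sum>h\<in>q k. increment f h)"
      proof (rule sum.UNION_disjoint[OF finI])
        show "\<forall>k\<in>I. finite (q k)" using div by blast
        show "\<forall>k\<in>I. \<forall>k'\<in>I. k \<noteq> k' \<longrightarrow> q k \<inter> q k' = {}"
        proof (intro ballI impI equals0I)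
          fix k k' h assume k: "k \<in> I" "k' \<in> I" "k \<noteq> k'" and h: "h \<in> q k \<inter> q k'"
          then have "h \<inter> h = {}" by (intro apart[OF k]) auto
          then show False using division_ofD(3)[OF div[OF k(1)], of h] h by simp
        qed
      qed
      also have "\<dots> = (\<Sum>k\<in>I. increment f k)"
      proof (rule sum.cong[OF refl])
        fix k assume k: "k \<in> I"
        obtain u v where uv: "u \<le> v" "k = {u..v}" using division_of_realE[OF I k] .
        then show "(\<Sum>h\<in>q k. increment f h) = increment f k"
          using sum_increment_division[of u v "q k" f] div[OF k] by simp
      qed
      finally show ?thesis .
    qed
  qed
qed

text \<open>Closed intervals are closed balls given by midpoint and radius, so the covering theorem
  for balls yields a countable disjoint subfamily that misses only a null set of \<open>E\<close>.
  Finitely many of its members already exhaust \<open>E\<close> up to measure \<open>e\<close>, and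
  a finite disjoint family of intervals is a division.\<close>

lemma Vitali_covering_intervals:
  fixes E :: "real set"
  assumes E: "E \<in> sets lebesgue" and "e > 0"
    and cover: "\<And>x d. x \<in> E \<Longrightarrow> 0 < d \<Longrightarrow> \<exists>u v. u < v \<and> x \<in> {u..v} \<and> v - u < d \<and> P u v"
    and bounded: "\<And>u v. P u v \<Longrightarrow> {u..v} \<subseteq> {a..b}"
  obtains D where "D division_of \<Union>D" "pairwise disjnt D"
    "\<And>k. k \<in> D \<Longrightarrow> \<exists>u v. u < v \<and> k = {u..v} \<and> P u v" "measure lebesgue (E - \<Union>D) < e"
proof -
  define K where "K = {(u, v). u < v \<and> P u v}"
  define m where "m = (\<lambda>(u, v). (u + v) / 2 :: real)"
  define r where "r = (\<lambda>(u, v). (v - u) / 2 :: real)"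
  have cb: "cball (m i) (r i) = {fst i..snd i}" for i
    by (cases i) (simp add: cball_eq_atLeastAtMost m_def r_def field_simps)
  obtain C where C: "countable C" "C \<subseteq> K"
    "pairwise (\<lambda>i j. disjnt (cball (m i) (r i)) (cball (m j) (r j))) C"
    "negligible (E - (\<Union>i \<in> C. cball (m i) (r i)))"
  proof (rule Vitali_covering_theorem_cballs[of K r E m])
    show "0 < r i" if "i \<in> K" for i using that by (auto simp: K_def r_def)
    fix x d :: real assume "x \<in> E" "0 < d"
    from cover[OF this] obtain u v where "u < v" "x \<in> {u..v}" "v - u < d" "P u v" by blast
    then show "\<exists>i. i \<in> K \<and> x \<in> cball (m i) (r i) \<and> r i < d"
      unfolding cb by (intro exI[of _ "(u, v)"]) (auto simp: K_def r_def)
  qed blast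
  define \<D> where "\<D> = (\<lambda>i. {fst i..snd i}) ` C"
  have sub: "k \<in> \<D> \<Longrightarrow> \<exists>u v. u < v \<and> k = {u..v} \<and> P u v" for k
  proof -
    assume "k \<in> \<D>"
    then obtain i where "i \<in> K" "k = {fst i..snd i}" using C(2) by (auto simp: \<D>_def)
    then show ?thesis by (cases i) (auto simp: K_def)
  qed
  have sub': "k \<subseteq> {a..b} \<and> k \<in> lmeasurable" if "k \<in> \<D>" for k
    using sub[OF that] bounded by (metis lmeasurable_cbox box_real(2))
  have cnt: "countable \<D>" using C(1) by (simp add: \<D>_def)
  have meas: "\<Union>D \<in> lmeasurable" if "D \<subseteq> \<D>" for D
  proof (rule bounded_set_imp_lmeasurable)
    have "\<Union>D \<subseteq> {a..b}" using that sub' by blast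
    then show "bounded (\<Union>D)" using bounded_closed_interval bounded_subset by blast
    show "\<Union>D \<in> sets lebesgue"
      using that sub' cnt by (intro sets.countable_Union) (auto intro: countable_subset)
  qed
  obtain D where D: "D \<subseteq> \<D>" "finite D"
    \<comment> \<open>All finite unions stay inside \<open>{a..b}\<close>; this uniform bound on
      their measure permits approximating the countable union by a finite one.\<close>
    "measure lebesgue (\<Union>\<D>) - e < measure lebesgue (\<Union>D)"
  proof (rule measure_countable_Union_approachable[OF cnt \<open>e > 0\<close>, of "measure lebesgue {a..b}"])
    show "\<And>d. d \<in> \<D> \<Longrightarrow> d \<in> lmeasurable" using sub' by blast
    fix D' assume "D' \<subseteq> \<D>" "finite D'"
    then show "measure lebesgue (\<Union>D') \<le> measure lebesgue {a..b}"
      using meas[of D'] sub' by (intro measure_mono_fmeasurable) (auto dest: fmeasurableD)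
  qed blast
  show thesis
  proof (rule that[of D])
    show disj: "pairwise disjnt D"
    proof (rule pairwiseI)
      fix k l assume "k \<in> D" "l \<in> D" "k \<noteq> l"
      then obtain i j where "i \<in> C" "j \<in> C" "k = {fst i..snd i}" "l = {fst j..snd j}"
        using D(1) unfolding \<D>_def by blast
      then show "disjnt k l" using pairwiseD[OF C(3), of i j] \<open>k \<noteq> l\<close> by (auto simp: cb)
    qed
    show "D division_of \<Union>D"
    proof (rule division_ofI)
      fix k assume k: "k \<in> D"
      then show "k \<subseteq> \<Union>D" by blast
      obtain u v where "u < v" "k = {u..v}" using sub k D(1) by blast
      then show "k \<noteq> {}" "\<exists>a b. k = cbox a b" by auto
      fix l assume "l \<in> D" "k \<noteq> l"
      then have "k \<inter> l = {}" using pairwiseD[OF disj k] by (simp add: disjnt_def)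
      then show "interior k \<inter> interior l = {}"
        using interior_subset[of k] interior_subset[of l] by blast
    qed (use D(2) in auto)
    show "\<exists>u v. u < v \<and> k = {u..v} \<and> P u v" if "k \<in> D" for k
      using sub that D(1) by blast
    have null: "E - \<Union>\<D> \<in> null_sets lebesgue"
      using C(4) by (simp add: cb \<D>_def negligible_iff_null_sets)
    have sets: "\<Union>\<D> \<in> sets lebesgue" "\<Union>D \<in> sets lebesgue"
      using meas[OF D(1)] meas[of \<D>] by (auto dest: fmeasurableD)
    \<comment> \<open>What \<open>D\<close> misses of \<open>E\<close> either lies in a discarded
      member of the countable family or in the null set missed by the whole family.\<close>
    have "measure lebesgue (E - \<Union>D) \<le> measure lebesgue ((\<Union>\<D> - \<Union>D) \<union> (E - \<Union>\<D>))"
    proof (rule measure_mono_fmeasurable)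
      show "E - \<Union>D \<in> sets lebesgue" using E sets(2) by (rule sets.Diff)
      show "(\<Union>\<D> - \<Union>D) \<union> (E - \<Union>\<D>) \<in> lmeasurable"
        by (rule fmeasurable.Un[OF fmeasurable_Diff[OF meas[OF subset_refl] sets(2)]
              fmeasurableI_null_sets[OF null]])
    qed blast
    also have "\<dots> = measure lebesgue (\<Union>\<D> - \<Union>D)"
      using null sets by (intro measure_Un_null_set sets.Diff)
    also have "\<dots> = measure lebesgue (\<Union>\<D>) - measure lebesgue (\<Union>D)"
      using meas[of \<D>] sets(2) Union_mono[OF D(1)] by (intro measurable_measure_Diff) simp_all
    also have "\<dots> < e" using D(3) by simp
    finally show "measure lebesgue (E - \<Union>D) < e" .
  qed
qed

section \<open>Null sets of points with oscillating or unbounded slopes\<close>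

lemma bounded_lmeasurable: "E \<in> sets lebesgue \<Longrightarrow> E \<subseteq> {a..b::real} \<Longrightarrow> E \<in> lmeasurable"
  by (meson bounded_closed_interval bounded_set_imp_lmeasurable bounded_subset)

text \<open>Disjoint intervals of slope at most \<open>p\<close> exhaust \<open>E\<close> up to a small error, and inside them
  intervals of slope at least \<open>q\<close> exhaust \<open>E\<close> again. By absolute continuity the increments over
  what lies between the two families are small, so \<open>q \<cdot> |E| \<le> p \<cdot> |E|\<close> up to a small error. Unlike
  in the classical proof for monotone functions, no monotonicity is needed.\<close>

lemma negligible_two_slopes:
  assumes f: "AC_on a b f" and E: "E \<in> sets lebesgue" "E \<subseteq> {a<..<b}" and "p < q"
    and low: "\<And>x d. x \<in> E \<Longrightarrow> 0 < d \<Longrightarrow>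
      \<exists>u v. u < v \<and> x \<in> {u..v} \<and> v - u < d \<and> f v - f u \<le> p * (v - u)"
    and high: "\<And>x d. x \<in> E \<Longrightarrow> 0 < d \<Longrightarrow>
      \<exists>u v. u < v \<and> x \<in> {u..v} \<and> v - u < d \<and> q * (v - u) \<le> f v - f u"
  shows "negligible E"
proof -
  have mE: "E \<in> lmeasurable"
    using E by (intro bounded_lmeasurable[of E a b]) auto
  have near: "{u..v} \<subseteq> G" if "x \<in> {u..v}" "v - u < d" "ball x d \<subseteq> G" for x u v d :: real and G
    using that by (force simp: dist_real_def)
  have bound: "(q - p) * measure lebesgue E \<le> \<epsilon> * (1 + \<bar>p\<bar> + \<bar>q\<bar>)" if "\<epsilon> > 0" for \<epsilon>
  proof -
    obtain \<delta>' where "\<delta>' > 0" and \<delta>': "\<And>D S. \<lbrakk>D division_of S; S \<subseteq> {a..b}; measure lebesgue S < \<delta>'\<rbrakk>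
       \<Longrightarrow> (\<Sum>k\<in>D. \<bar>increment f k\<bar>) < \<epsilon>"
      using AC_on_divisionE[OF f \<open>\<epsilon> > 0\<close>] by blast
    \<comment> \<open>Being at most \<open>\<delta>'\<close> makes absolute continuity applicable to
      the leftover pieces; being at most \<open>\<epsilon>\<close> turns the measure errors below
      into multiples of \<open>\<epsilon>\<close>.\<close>
    define \<delta> where "\<delta> = min \<delta>' \<epsilon>"
    have \<delta>: "\<delta> > 0" "\<delta> \<le> \<delta>'" "\<delta> \<le> \<epsilon>" using \<open>\<delta>' > 0\<close> \<open>\<epsilon> > 0\<close> by (auto simp: \<delta>_def)
    \<comment> \<open>An open set barely larger than \<open>E\<close> that contains all intervals of
      the first family, so that their union cannot have much more measure than
      \<open>E\<close>.\<close>
    obtain G0 where G0: "open G0" "E \<subseteq> G0" "G0 - E \<in> lmeasurable" "emeasure lebesgue (G0 - E) < ennreal (\<delta> / 4)"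
      using sets_lebesgue_outer_open[OF E(1), of "\<delta> / 4"] \<delta>(1) by auto
    define G where "G = G0 \<inter> {a<..<b}"
    have G: "open G" "E \<subseteq> G" "G \<subseteq> {a..b}" using G0 E(2) by (auto simp: G_def)
    have mG: "G \<in> lmeasurable" using G by (intro bounded_lmeasurable) auto
    have "measure lebesgue G - measure lebesgue E = measure lebesgue (G - E)"
      using mG E(1) G(2) by (rule measurable_measure_Diff[symmetric])
    also have "\<dots> \<le> measure lebesgue (G0 - E)"
      using G0(3) mG E(1) by (intro measure_mono_fmeasurable) (auto simp: G_def dest: fmeasurableD)
    also have "\<dots> < \<delta> / 4"
      using G0(4) \<delta>(1) by (simp add: emeasure_eq_measure2[OF G0(3)] ennreal_less_iff)
    finally have GE: "measure lebesgue G < measure lebesgue E + \<delta> / 4" by simp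
    obtain I where I: "I division_of \<Union>I" "pairwise disjnt I"
      and Iv: "\<And>k. k \<in> I \<Longrightarrow> \<exists>u v. u < v \<and> k = {u..v} \<and> {u..v} \<subseteq> G \<and> f v - f u \<le> p * (v - u)"
      and IE: "measure lebesgue (E - \<Union>I) < \<delta> / 4"
    proof (rule Vitali_covering_intervals[OF E(1), of "\<delta> / 4" "\<lambda>u v. {u..v} \<subseteq> G \<and> f v - f u \<le> p * (v - u)" a b])
      fix x d :: real assume "x \<in> E" "0 < d"
      obtain r where r: "r > 0" "ball x r \<subseteq> G" using \<open>x \<in> E\<close> G by (meson open_contains_ball subset_iff)
      obtain u v where "u < v" "x \<in> {u..v}" "v - u < min d r" "f v - f u \<le> p * (v - u)"
        using low[OF \<open>x \<in> E\<close>, of "min d r"] r \<open>0 < d\<close> by auto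
      then show "\<exists>u v. u < v \<and> x \<in> {u..v} \<and> v - u < d \<and> {u..v} \<subseteq> G \<and> f v - f u \<le> p * (v - u)"
        using near[of x u v r G] r by (intro exI[of _ u] exI[of _ v]) auto
    next
      fix u v assume "{u..v} \<subseteq> G \<and> f v - f u \<le> p * (v - u)"
      then show "{u..v} \<subseteq> {a..b}" using G(3) by blast
    qed (use \<delta> in auto)
    have finI: "finite I" using I(1) by blast
    \<comment> \<open>The second family must nest in the first. A point of \<open>V\<close> has a
      whole ball inside some member of \<open>I\<close>, so short intervals around it nest
      automatically.\<close>
    define V where "V = (\<Union>k\<in>I. interior k)"
    have V: "open V" by (auto simp: V_def)
    have EV: "E \<inter> V \<in> sets lebesgue" using E(1) V by auto
    obtain J where J: "J division_of \<Union>J"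
      and Jv: "\<And>j. j \<in> J \<Longrightarrow> \<exists>u v. u < v \<and> j = {u..v} \<and> (\<exists>k\<in>I. {u..v} \<subseteq> k) \<and> q * (v - u) \<le> f v - f u"
      and JE: "measure lebesgue (E \<inter> V - \<Union>J) < \<delta> / 4"
    proof (rule Vitali_covering_intervals[OF EV, of "\<delta> / 4" "\<lambda>u v. (\<exists>k\<in>I. {u..v} \<subseteq> k) \<and> q * (v - u) \<le> f v - f u" a b])
      fix x d :: real assume "x \<in> E \<inter> V" "0 < d"
      then obtain k where k: "k \<in> I" "x \<in> interior k" by (auto simp: V_def)
      then obtain r where r: "r > 0" "ball x r \<subseteq> k" by (meson mem_interior)
      obtain u v where "u < v" "x \<in> {u..v}" "v - u < min d r" "q * (v - u) \<le> f v - f u"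
        using high[of x "min d r"] \<open>x \<in> E \<inter> V\<close> r \<open>0 < d\<close> by auto
      then show "\<exists>u v. u < v \<and> x \<in> {u..v} \<and> v - u < d \<and> (\<exists>k\<in>I. {u..v} \<subseteq> k) \<and> q * (v - u) \<le> f v - f u"
        using near[of x u v r k] r k(1) by (intro exI[of _ u] exI[of _ v]) auto
    next
      fix u v assume "(\<exists>k\<in>I. {u..v} \<subseteq> k) \<and> q * (v - u) \<le> f v - f u"
      then show "{u..v} \<subseteq> {a..b}" using Iv G(3) by blast
    qed (use \<delta> in auto)
    have subI: "\<Union>I \<subseteq> G" using Iv by (intro Union_least) metis
    have JI: "\<exists>k\<in>I. j \<subseteq> k" if "j \<in> J" for j using Jv[OF that] by blast
    then have sub: "\<Union>J \<subseteq> \<Union>I" by blast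
    have mI: "\<Union>I \<in> lmeasurable" using I(1) lmeasurable_division by blast
    have mJ: "\<Union>J \<in> lmeasurable" using J lmeasurable_division by blast
    \<comment> \<open>Passing from \<open>\<Union>I\<close> to \<open>V\<close> loses only endpoints
      of finitely many intervals.\<close>
    have bd: "\<Union>I - V \<in> null_sets lebesgue"
    proof -
      have "negligible (\<Union>k\<in>I. k - interior k)"
      proof (rule negligible_Union)
        fix t assume "t \<in> (\<lambda>k. k - interior k) ` I"
        then obtain k where "k \<in> I" and t: "t = k - interior k" by blast
        then obtain u v where "k = {u..v}" using division_of_realE[OF I(1)] by metis
        then have "k - interior k \<subseteq> {u, v}" by auto
        then show "negligible t" unfolding t by (rule negligible_subset[rotated]) simp
      qed (use finI in auto)
      then have "negligible (\<Union>I - V)" by (rule negligible_subset) (auto simp: V_def)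
      then show ?thesis by (simp add: negligible_iff_null_sets)
    qed
    have EJ: "measure lebesgue (E - \<Union>J) \<le> \<delta> / 2"
    proof -
      have m1: "E - \<Union>I \<in> lmeasurable" "E \<inter> V - \<Union>J \<in> lmeasurable"
        using mE mI mJ V by (auto intro!: fmeasurable_Diff fmeasurable_Int_fmeasurable dest: fmeasurableD)
      have "measure lebesgue (E - \<Union>J) \<le> measure lebesgue ((E - \<Union>I) \<union> (E \<inter> V - \<Union>J) \<union> (\<Union>I - V))"
        using m1 bd mE mJ
        by (intro measure_mono_fmeasurable fmeasurable.Un)
           (auto intro: fmeasurableI_null_sets dest: fmeasurableD)
      also have "\<dots> = measure lebesgue ((E - \<Union>I) \<union> (E \<inter> V - \<Union>J))"
        using m1 bd by (intro measure_Un_null_set) (auto dest: fmeasurableD)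
      also have "\<dots> \<le> measure lebesgue (E - \<Union>I) + measure lebesgue (E \<inter> V - \<Union>J)"
        using m1 by (intro measure_Un_le) (auto dest: fmeasurableD)
      finally show ?thesis using IE JE by simp
    qed
    have diff: "measure lebesgue E - measure lebesgue S \<le> measure lebesgue (E - S)"
      if "S \<in> lmeasurable" for S
    proof -
      have "measure lebesgue E \<le> measure lebesgue ((E - S) \<union> S)"
        using that mE by (intro measure_mono_fmeasurable fmeasurable.Un fmeasurable_Diff) (auto dest: fmeasurableD)
      also have "\<dots> \<le> measure lebesgue (E - S) + measure lebesgue S"
        using that mE by (intro measure_Un_le) (auto dest: fmeasurableD)
      finally show ?thesis by simp
    qed
    let ?e = "measure lebesgue E" and ?s = "measure lebesgue (\<Union>I)" and ?t = "measure lebesgue (\<Union>J)"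
    have s1: "?s \<le> ?e + \<delta> / 4"
      using GE measure_mono_fmeasurable[OF subI _ mG] mI by (auto dest: fmeasurableD)
    have s2: "?e - \<delta> / 4 \<le> ?s" using diff[OF mI] IE by simp
    have t1: "?t \<le> ?s" using measure_mono_fmeasurable[OF sub _ mI] mJ by (auto dest: fmeasurableD)
    have t2: "?e - \<delta> / 2 \<le> ?t" using diff[OF mJ] EJ by simp
    \<comment> \<open>Completes the steep intervals \<open>J\<close> to a division of
      \<open>\<Union>I\<close> with unchanged total increment. The added pieces have total measure
      \<open>?s - ?t\<close>, small enough for absolute continuity to bound their increments by
      \<open>\<epsilon>\<close>.\<close>
    obtain Q where Q: "Q division_of \<Union>I" "J \<subseteq> Q"
      and Qs: "\<And>f. (\<Sum>k\<in>Q. increment f k) = (\<Sum>k\<in>I. increment f k)"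
      using division_refineE[OF I J JI] by blast
    have finQ: "finite Q" using Q(1) by blast
    have div': "Q - J division_of \<Union>(Q - J)"
      by (rule division_of_subset[of Q]) (use Q in auto)
    have "measure lebesgue (\<Union>(Q - J)) = (\<Sum>k\<in>Q - J. measure lebesgue k)"
      using content_division[OF div'] by simp
    also have "\<dots> = ?s - ?t"
      using sum.subset_diff[OF Q(2) finQ, of "measure lebesgue"] content_division[OF Q(1)] content_division[OF J] by simp
    also have "\<dots> < \<delta>'" using s1 t2 \<delta> by linarith
    finally have "(\<Sum>k\<in>Q - J. \<bar>increment f k\<bar>) < \<epsilon>"
      by (intro \<delta>'[OF div'])
         (use division_ofD(6)[OF Q(1)] subI G(3) in auto)
    then have rest: "- \<epsilon> \<le> (\<Sum>k\<in>Q - J. increment f k)"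
      using sum_abs[of "increment f" "Q - J"] by linarith
    have "q * ?t = (\<Sum>k\<in>J. q * measure lebesgue k)"
      unfolding content_division[OF J, symmetric] by (rule sum_distrib_left)
    also have "\<dots> \<le> (\<Sum>k\<in>J. increment f k)"
    proof (rule sum_mono)
      fix k assume "k \<in> J"
      from Jv[OF this] show "q * measure lebesgue k \<le> increment f k" by auto
    qed
    also have "\<dots> = (\<Sum>k\<in>I. increment f k) - (\<Sum>k\<in>Q - J. increment f k)"
      using sum.subset_diff[OF Q(2) finQ, of "increment f"] Qs by simp
    also have "\<dots> \<le> (\<Sum>k\<in>I. p * measure lebesgue k) + \<epsilon>"
    proof -
      have "(\<Sum>k\<in>I. increment f k) \<le> (\<Sum>k\<in>I. p * measure lebesgue k)"
      proof (rule sum_mono)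
        fix k assume "k \<in> I"
        from Iv[OF this] show "increment f k \<le> p * measure lebesgue k" by auto
      qed
      then show ?thesis using rest by simp
    qed
    also have "(\<Sum>k\<in>I. p * measure lebesgue k) = p * ?s"
      unfolding content_division[OF I(1), symmetric] by (rule sum_distrib_left[symmetric])
    finally have main: "q * ?t \<le> p * ?s + \<epsilon>" .
    \<comment> \<open>Replacing both measures in \<open>main\<close> by that of \<open>E\<close>
      costs at most \<bar>p\<bar> \<epsilon> and \<bar>q\<bar> \<epsilon>, whatever the signs of
      \<open>p\<close> and \<open>q\<close>. Hence the factor in \<open>bound\<close>.\<close>
    have "\<bar>?s - ?e\<bar> \<le> \<epsilon>" "\<bar>?t - ?e\<bar> \<le> \<epsilon>" using s1 s2 t1 t2 \<delta> by linarith+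
    then have "p * (?s - ?e) \<le> \<bar>p\<bar> * \<epsilon>" "- (q * (?t - ?e)) \<le> \<bar>q\<bar> * \<epsilon>"
      by (metis abs_ge_self abs_ge_zero abs_mult mult_left_mono order_trans,
          metis abs_ge_minus_self abs_ge_zero abs_mult mult_left_mono order_trans)
    then show ?thesis using main by (simp add: algebra_simps)
  qed
  have "(q - p) * measure lebesgue E \<le> 0"
  proof (rule field_le_epsilon)
    fix e :: real assume "e > 0"
    define c where "c = 1 + \<bar>p\<bar> + \<bar>q\<bar>"
    have c: "c > 0" by (simp add: c_def)
    then show "(q - p) * measure lebesgue E \<le> 0 + e"
      using bound[of "e / c", folded c_def] \<open>e > 0\<close> by simp
  qed
  then have "measure lebesgue E = 0"
    using \<open>p < q\<close> measure_nonneg[of lebesgue E] by (simp add: mult_le_0_iff)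
  then show ?thesis using mE by (simp add: negligible_iff_measure)
qed

text \<open>On a short enough ball every division has total absolute increment below 1. If
  \<open>E\<close> had positive measure there, disjoint intervals of slope at least \<open>n\<close>
  covering half of it would give more than 1 for large \<open>n\<close>. Local negligibility then
  gives the claim.\<close>

lemma negligible_unbounded_slopes:
  assumes f: "AC_on a b f" and E: "E \<in> sets lebesgue" "E \<subseteq> {a<..<b}"
    and steep: "\<And>x d n. x \<in> E \<Longrightarrow> 0 < d \<Longrightarrow>
      \<exists>u v. u < v \<and> x \<in> {u..v} \<and> v - u < d \<and> real n * (v - u) \<le> \<bar>f v - f u\<bar>"
  shows "negligible E"
proof -
  obtain \<delta> where "\<delta> > 0" and \<delta>: "\<And>D S. \<lbrakk>D division_of S; S \<subseteq> {a..b}; measure lebesgue S < \<delta>\<rbrakk>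
       \<Longrightarrow> (\<Sum>k\<in>D. \<bar>increment f k\<bar>) < 1"
    using AC_on_divisionE[OF f, of 1, simplified] by blast
  have near: "{u..v} \<subseteq> G" if "x \<in> {u..v}" "v - u < d" "ball x d \<subseteq> G" for x u v d :: real and G
    using that by (force simp: dist_real_def)
  \<comment> \<open>The radius makes the length of the ball two thirds of \<open>\<delta>\<close>,
    so absolute continuity applies to every division inside it.\<close>
  have loc: "negligible (E \<inter> ball z (\<delta> / 3))" for z
  proof -
    define B where "B = ball z (\<delta> / 3)"
    define A where "A = E \<inter> B"
    have sA: "A \<in> sets lebesgue" using E(1) by (auto simp: A_def B_def)
    have mA: "A \<in> lmeasurable" using E sA by (intro bounded_lmeasurable[of A a b]) (auto simp: A_def)
    define e where "e = measure lebesgue A"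
    have "e \<ge> 0" by (simp add: e_def)
    have "\<not> e > 0"
    proof
      assume "e > 0"
      \<comment> \<open>The intervals found below cover at least measure \<open>e / 2\<close>, so
        this slope forces a total increment above 1.\<close>
      obtain n where n: "real n > 2 / e" using reals_Archimedean2 by blast
      obtain D where D: "D division_of \<Union>D"
        and Dv: "\<And>k. k \<in> D \<Longrightarrow> \<exists>u v. u < v \<and> k = {u..v} \<and> {u..v} \<subseteq> B \<inter> {a<..<b} \<and> real n * (v - u) \<le> \<bar>f v - f u\<bar>"
        and DA: "measure lebesgue (A - \<Union>D) < e / 2"
      proof (rule Vitali_covering_intervals[OF sA, of "e / 2"
            "\<lambda>u v. {u..v} \<subseteq> B \<inter> {a<..<b} \<and> real n * (v - u) \<le> \<bar>f v - f u\<bar>" a b])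
        fix x d :: real assume x: "x \<in> A" "0 < d"
        have "open (B \<inter> {a<..<b})" "x \<in> B \<inter> {a<..<b}" using x E(2) by (auto simp: A_def B_def)
        then obtain r where r: "r > 0" "ball x r \<subseteq> B \<inter> {a<..<b}" by (meson open_contains_ball)
        obtain u v where "u < v" "x \<in> {u..v}" "v - u < min d r" "real n * (v - u) \<le> \<bar>f v - f u\<bar>"
          using steep[of x "min d r" n] x r by (auto simp: A_def)
        then show "\<exists>u v. u < v \<and> x \<in> {u..v} \<and> v - u < d \<and> {u..v} \<subseteq> B \<inter> {a<..<b} \<and> real n * (v - u) \<le> \<bar>f v - f u\<bar>"
          using near[of x u v r "B \<inter> {a<..<b}"] r by (intro exI[of _ u] exI[of _ v]) auto
      next
        fix u v assume "{u..v} \<subseteq> B \<inter> {a<..<b} \<and> real n * (v - u) \<le> \<bar>f v - f u\<bar>"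
        then show "{u..v} \<subseteq> {a..b}" by force
      qed (use \<open>e > 0\<close> in auto)
      have mD: "\<Union>D \<in> lmeasurable" using D lmeasurable_division by blast
      have sub: "\<Union>D \<subseteq> B \<inter> {a<..<b}" using Dv by (intro Union_least) metis
      have "measure lebesgue (\<Union>D) \<le> measure lebesgue B"
        using sub mD by (intro measure_mono_fmeasurable) (auto simp: B_def dest: fmeasurableD)
      also have "\<dots> < \<delta>" using \<open>\<delta> > 0\<close> by (simp add: B_def ball_eq_greaterThanLessThan)
      finally have "(\<Sum>k\<in>D. \<bar>increment f k\<bar>) < 1"
        by (intro \<delta>[OF D]) (use sub in auto)
      moreover have "real n * measure lebesgue (\<Union>D) \<le> (\<Sum>k\<in>D. \<bar>increment f k\<bar>)"
      proof -
        have "real n * measure lebesgue k \<le> \<bar>increment f k\<bar>" if "k \<in> D" for k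
          using Dv[OF that] by auto
        then have "(\<Sum>k\<in>D. real n * measure lebesgue k) \<le> (\<Sum>k\<in>D. \<bar>increment f k\<bar>)"
          by (rule sum_mono)
        then show ?thesis using content_division[OF D] by (simp add: sum_distrib_left[symmetric])
      qed
      moreover have "e / 2 \<le> measure lebesgue (\<Union>D)"
      proof -
        have "e \<le> measure lebesgue ((A - \<Union>D) \<union> \<Union>D)"
          unfolding e_def using mA mD
          by (intro measure_mono_fmeasurable fmeasurable.Un fmeasurable_Diff) (auto dest: fmeasurableD)
        also have "\<dots> \<le> measure lebesgue (A - \<Union>D) + measure lebesgue (\<Union>D)"
          using mA mD by (intro measure_Un_le) (auto dest: fmeasurableD)
        finally show ?thesis using DA by simp
      qed
      ultimately have "real n * (e / 2) < 1"
        by (meson mult_left_mono of_nat_0_le_iff order.strict_trans1)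
      then show False using n \<open>e > 0\<close> by (simp add: field_simps)
    qed
    then have "measure lebesgue A = 0" using \<open>e \<ge> 0\<close> unfolding e_def by linarith
    then show ?thesis using mA by (simp add: negligible_iff_measure A_def B_def)
  qed
  show ?thesis
  proof (rule locally_negligible_alt[THEN iffD2], rule ballI)
    fix x assume "x \<in> E"
    then show "\<exists>U. openin (top_of_set E) U \<and> x \<in> U \<and> negligible U"
      using loc[of x] \<open>\<delta> > 0\<close> openin_open_Int[OF open_ball, of E x "\<delta> / 3"]
      by (intro exI[of _ "E \<inter> ball x (\<delta> / 3)"]) simp
  qed
qed

section \<open>Differentiability almost everywhere\<close>

lemma AC_on_imp_continuous_on:
  assumes "AC_on a b f"
  shows "continuous_on {a..b} f"
  unfolding continuous_on_iff
proof (intro ballI allI impI)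
  fix x e :: real assume x: "x \<in> {a..b}" and "0 < e"
  obtain \<delta> where "\<delta> > 0" and \<delta>: "\<And>D S. \<lbrakk>D division_of S; S \<subseteq> {a..b}; measure lebesgue S < \<delta>\<rbrakk>
       \<Longrightarrow> (\<Sum>k\<in>D. \<bar>increment f k\<bar>) < e"
    using AC_on_divisionE[OF assms \<open>0 < e\<close>] by blast
  have small: "\<bar>f v - f u\<bar> < e" if "u \<in> {a..b}" "v \<in> {a..b}" "u \<le> v" "v - u < \<delta>" for u v
  proof -
    have "{cbox u v} division_of cbox u v" using that by (intro division_of_self) auto
    from \<delta>[OF this] show ?thesis using that by simp
  qed
  show "\<exists>d>0. \<forall>x'\<in>{a..b}. dist x' x < d \<longrightarrow> dist (f x') (f x) < e"
  proof (intro exI[of _ \<delta>] conjI ballI impI)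
    fix y assume "y \<in> {a..b}" "dist y x < \<delta>"
    then show "dist (f y) (f x) < e"
      using small[of x y] small[of y x] x by (cases "x \<le> y") (auto simp: dist_real_def)
  qed (rule \<open>\<delta> > 0\<close>)
qed

text \<open>For fixed \<open>y\<close> the points \<open>x\<close> whose slope towards
  \<open>y\<close> lies in the open set \<open>T\<close> form an open set. A union over uncountably
  many \<open>y\<close> stays open, so the set in question is a countable intersection of open sets
  with \<open>{a<..<b}\<close>.\<close>

lemma borel_frequently_slope:
  fixes f :: "real \<Rightarrow> real"
  assumes f: "continuous_on {a<..<b} f" and T: "open T"
  shows "{x \<in> {a<..<b}. \<exists>\<^sub>F y in at x. (f y - f x) / (y - x) \<in> T} \<in> sets borel"
proof -
  \<comment> \<open>\<open>A n y\<close> collects the points other than \<open>y\<close> within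
    distance 1/(n+1) of \<open>y\<close> whose slope towards \<open>y\<close> lies in
    \<open>T\<close>.\<close>
  define A where "A = (\<lambda>(n :: nat) y. ({a<..<b} - {y}) \<inter> ball y (1 / Suc n) \<inter>
    {x \<in> {a<..<b} - {y}. (f y - f x) / (y - x) \<in> T})"
  have "open (A n y)" if "y \<in> {a<..<b}" for n y
  proof -
    have "continuous_on ({a<..<b} - {y}) (\<lambda>x. (f y - f x) / (y - x))"
      by (intro continuous_intros continuous_on_subset[OF f]) auto
    from continuous_open_preimage[OF this _ T]
    have "open {x \<in> {a<..<b} - {y}. (f y - f x) / (y - x) \<in> T}"
      by (simp add: vimage_def Int_def open_Diff)
    then show ?thesis unfolding A_def by (intro open_Int open_Diff) auto
  qed
  then have "open (\<Union>y\<in>{a<..<b}. A n y)" for n by blast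
  then have "(\<Inter>n. \<Union>y\<in>{a<..<b}. A n y) \<in> sets borel" by (intro sets.countable_INT') auto
  moreover have "{x \<in> {a<..<b}. \<exists>\<^sub>F y in at x. (f y - f x) / (y - x) \<in> T} =
      {a<..<b} \<inter> (\<Inter>n. \<Union>y\<in>{a<..<b}. A n y)"
  proof (intro equalityI subsetI)
    fix x assume "x \<in> {x \<in> {a<..<b}. \<exists>\<^sub>F y in at x. (f y - f x) / (y - x) \<in> T}"
    then have x: "x \<in> {a<..<b}" and fr: "\<exists>\<^sub>F y in at x. (f y - f x) / (y - x) \<in> T" by auto
    have "x \<in> (\<Union>y\<in>{a<..<b}. A n y)" for n
    proof -
      obtain r where r: "r > 0" "ball x r \<subseteq> {a<..<b}"
        using x by (meson open_contains_ball open_greaterThanLessThan)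
      have "min r (1 / Suc n) > 0" using r by simp
      then obtain y where "y \<noteq> x" "dist y x < min r (1 / Suc n)" "(f y - f x) / (y - x) \<in> T"
        using fr unfolding frequently_at by blast
      moreover from this have "y \<in> {a<..<b}" using r(2) by (auto simp: dist_commute)
      ultimately show ?thesis using x by (intro UN_I[of y]) (auto simp: A_def)
    qed
    then show "x \<in> {a<..<b} \<inter> (\<Inter>n. \<Union>y\<in>{a<..<b}. A n y)" using x by blast
  next
    fix x assume x: "x \<in> {a<..<b} \<inter> (\<Inter>n. \<Union>y\<in>{a<..<b}. A n y)"
    have "\<exists>y. y \<noteq> x \<and> dist y x < d \<and> (f y - f x) / (y - x) \<in> T" if "d > 0" for d
    proof -
      obtain n where n: "1 / Suc n < d" using nat_approx_posE[OF \<open>0 < d\<close>] by blast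
      obtain y where "x \<in> A n y" using x by blast
      then show ?thesis using n by (intro exI[of _ y]) (auto simp: A_def)
    qed
    then show "x \<in> {x \<in> {a<..<b}. \<exists>\<^sub>F y in at x. (f y - f x) / (y - x) \<in> T}"
      using x by (auto simp: frequently_at)
  qed
  ultimately show ?thesis by simp
qed

text \<open>Supplies the fineness condition of a Vitali covering. The difference quotient is
  symmetric in its two points, so an interval with \<open>x\<close> as its left or right endpoint
  serves equally well.\<close>

lemma frequently_slope_interval:
  fixes f :: "real \<Rightarrow> real"
  assumes "\<exists>\<^sub>F y in at x. P ((f y - f x) / (y - x))" "0 < d"
  shows "\<exists>u v. u < v \<and> x \<in> {u..v} \<and> v - u < d \<and> P ((f v - f u) / (v - u))"
proof -
  obtain y where y: "y \<noteq> x" "dist y x < d" "P ((f y - f x) / (y - x))"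
    using assms unfolding frequently_at by blast
  show ?thesis
  proof (cases "x < y")
    case True
    then show ?thesis using y by (intro exI[of _ x] exI[of _ y]) (auto simp: dist_real_def)
  next
    case False
    have "(f x - f y) / (x - y) = (f y - f x) / (y - x)"
      by (metis minus_diff_eq minus_divide_divide)
    then show ?thesis using y False by (intro exI[of _ y] exI[of _ x]) (auto simp: dist_real_def)
  qed
qed

text \<open>Two rationals fit strictly between distinct lower and upper limits, and the quantity
  then crosses both frequently. Rational levels are used so that the exceptional sets for
  differentiability form a countable family.\<close>

lemma bounded_nonoscillating_convergent:
  fixes Q :: "'a \<Rightarrow> real"
  assumes F: "F \<noteq> bot" and bounded: "\<forall>\<^sub>F y in F. \<bar>Q y\<bar> \<le> M"
    and osc: "\<And>p q :: rat. p < q \<Longrightarrow>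
      \<not> ((\<exists>\<^sub>F y in F. Q y < of_rat p) \<and> (\<exists>\<^sub>F y in F. of_rat q < Q y))"
  shows "\<exists>L. (Q \<longlongrightarrow> L) F"
proof -
  let ?l = "Liminf F (\<lambda>y. ereal (Q y))" and ?u = "Limsup F (\<lambda>y. ereal (Q y))"
  have "\<not> ?l < ?u"
  proof
    assume "?l < ?u"
    then obtain q :: rat where q: "?l < ereal (of_rat q)" "ereal (of_rat q) < ?u"
      using ereal_dense3 by blast
    then obtain p :: rat where p: "?l < ereal (of_rat p)" "ereal (of_rat p) < ereal (of_rat q)"
      using ereal_dense3 by blast
    have "p < q" using p(2) by (simp add: of_rat_less)
    moreover have "\<exists>\<^sub>F y in F. Q y < of_rat p"
    proof (rule ccontr)
      assume "\<not> ?thesis"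
      then have "\<forall>\<^sub>F y in F. ereal (of_rat p) \<le> ereal (Q y)" by (simp add: not_frequently not_less)
      from Liminf_bounded[OF this] show False using p(1) by simp
    qed
    moreover have "\<exists>\<^sub>F y in F. of_rat q < Q y"
    proof (rule ccontr)
      assume "\<not> ?thesis"
      then have "\<forall>\<^sub>F y in F. ereal (Q y) \<le> ereal (of_rat q)" by (simp add: not_frequently not_less)
      from Limsup_bounded[OF this] show False using q(2) by simp
    qed
    ultimately show False using osc by blast
  qed
  then have eq: "?l = ?u" using Liminf_le_Limsup[OF F, of "\<lambda>y. ereal (Q y)"] by simp
  then have lim: "((\<lambda>y. ereal (Q y)) \<longlongrightarrow> ?l) F"
    using tendsto_iff_Liminf_eq_Limsup[OF F, of "\<lambda>y. ereal (Q y)"] by simp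
  \<comment> \<open>The bound keeps the common value of the lower and upper limits finite.\<close>
  have "ereal (- M) \<le> ?l"
    by (rule Liminf_bounded) (use bounded in \<open>auto elim!: eventually_mono\<close>)
  moreover have "?l \<le> ereal M" unfolding eq
    by (rule Limsup_bounded) (use bounded in \<open>auto elim!: eventually_mono\<close>)
  ultimately obtain L where "?l = ereal L" by (cases ?l) auto
  then show ?thesis using lim by auto
qed

text \<open>If the difference quotients at a point have no limit, they are unbounded near it
  (\<open>N1\<close>) or fall frequently below \<open>p\<close> and above \<open>q\<close> for some
  rationals p < q (\<open>N2 p q\<close>). Each set is negligible by one of the slope lemmas, and
  there are countably many pairs.\<close>

lemma negligible_not_differentiable_AC_on:
  assumes f: "AC_on a b f"
  shows "negligible {x \<in> {a<..<b}. \<not> f differentiable at x}"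
proof -
  define S where "S = (\<lambda>T. {x \<in> {a<..<b}. \<exists>\<^sub>F y in at x. (f y - f x) / (y - x) \<in> T})"
  have cont: "continuous_on {a<..<b} f"
    by (rule continuous_on_subset[OF AC_on_imp_continuous_on[OF f]]) auto
  have S_sets: "S T \<in> sets lebesgue" if "open T" for T
    using borel_frequently_slope[OF cont that] by (simp add: S_def)
  define N1 where "N1 = (\<Inter>n. S {z. real n < \<bar>z\<bar>})"
  define N2 where "N2 = (\<lambda>p q :: rat. S {..<of_rat p} \<inter> S {of_rat q<..})"
  have op: "open {z. real n < \<bar>z\<bar>}" for n
    by (intro open_Collect_less continuous_intros)
  have "negligible N1"
  proof (rule negligible_unbounded_slopes[OF f])
    show "N1 \<in> sets lebesgue" unfolding N1_def using S_sets[OF op] by (intro sets.countable_INT') auto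
    show "N1 \<subseteq> {a<..<b}" by (auto simp: N1_def S_def)
    fix x d :: real and n :: nat assume "x \<in> N1" "0 < d"
    then have "\<exists>\<^sub>F y in at x. real n < \<bar>(f y - f x) / (y - x)\<bar>" by (auto simp: N1_def S_def)
    from frequently_slope_interval[where P = "\<lambda>z. real n < \<bar>z\<bar>", OF this \<open>0 < d\<close>]
    obtain u v where uv: "u < v" "x \<in> {u..v}" "v - u < d" "real n < \<bar>(f v - f u) / (v - u)\<bar>" by blast
    then have "real n * (v - u) \<le> \<bar>f v - f u\<bar>" by (simp add: abs_divide field_simps)
    then show "\<exists>u v. u < v \<and> x \<in> {u..v} \<and> v - u < d \<and> real n * (v - u) \<le> \<bar>f v - f u\<bar>"
      using uv by blast
  qed
  moreover have "negligible (N2 p q)" if "p < q" for p q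
  proof (rule negligible_two_slopes[OF f, where p = "of_rat p" and q = "of_rat q"])
    show "N2 p q \<in> sets lebesgue" unfolding N2_def by (intro sets.Int S_sets) auto
    show "N2 p q \<subseteq> {a<..<b}" by (auto simp: N2_def S_def)
    show "(of_rat p :: real) < of_rat q" using that by (simp add: of_rat_less)
    fix x d :: real assume x: "x \<in> N2 p q" and "0 < d"
    then have low: "\<exists>\<^sub>F y in at x. (f y - f x) / (y - x) < of_rat p"
      and high: "\<exists>\<^sub>F y in at x. of_rat q < (f y - f x) / (y - x)" by (auto simp: N2_def S_def)
    from frequently_slope_interval[where P = "\<lambda>z. z < of_rat p", OF low \<open>0 < d\<close>]
    obtain u v where uv: "u < v" "x \<in> {u..v}" "v - u < d" "(f v - f u) / (v - u) < of_rat p" by blast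
    then have "f v - f u \<le> of_rat p * (v - u)" by (simp add: field_simps)
    then show "\<exists>u v. u < v \<and> x \<in> {u..v} \<and> v - u < d \<and> f v - f u \<le> of_rat p * (v - u)"
      using uv by blast
    from frequently_slope_interval[where P = "\<lambda>z. of_rat q < z", OF high \<open>0 < d\<close>]
    obtain u v where uv: "u < v" "x \<in> {u..v}" "v - u < d" "of_rat q < (f v - f u) / (v - u)" by blast
    then have "of_rat q * (v - u) \<le> f v - f u" by (simp add: field_simps)
    then show "\<exists>u v. u < v \<and> x \<in> {u..v} \<and> v - u < d \<and> of_rat q * (v - u) \<le> f v - f u"
      using uv by blast
  qed
  ultimately have "N1 \<union> (\<Union>(p, q)\<in>{(p, q). p < q}. N2 p q) \<in> null_sets lebesgue"
    by (intro null_sets.Un null_sets_UN') (auto simp: negligible_iff_null_sets)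
  then have "negligible (N1 \<union> (\<Union>(p, q)\<in>{(p, q). p < q}. N2 p q))"
    by (simp add: negligible_iff_null_sets)
  then show ?thesis
  proof (rule negligible_subset, intro subsetI)
    fix x assume "x \<in> {x \<in> {a<..<b}. \<not> f differentiable at x}"
    then have x: "x \<in> {a<..<b}" and nd: "\<not> f differentiable at x" by auto
    show "x \<in> N1 \<union> (\<Union>(p, q)\<in>{(p, q). p < q}. N2 p q)"
    proof (rule ccontr)
      assume c: "\<not> ?thesis"
      then obtain n where "x \<notin> S {z. real n < \<bar>z\<bar>}" by (auto simp: N1_def)
      then have bounded: "\<forall>\<^sub>F y in at x. \<bar>(f y - f x) / (y - x)\<bar> \<le> real n"
        using x by (simp add: S_def not_frequently not_less)
      have "\<exists>L. ((\<lambda>y. (f y - f x) / (y - x)) \<longlongrightarrow> L) (at x)"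
      proof (rule bounded_nonoscillating_convergent[OF _ bounded])
        fix p q :: rat assume "p < q"
        then have "x \<notin> N2 p q" using c by auto
        then show "\<not> ((\<exists>\<^sub>F y in at x. (f y - f x) / (y - x) < of_rat p) \<and>
            (\<exists>\<^sub>F y in at x. of_rat q < (f y - f x) / (y - x)))"
          using x by (auto simp: N2_def S_def)
      qed simp
      then obtain L where "(f has_real_derivative L) (at x)"
        by (auto simp: has_field_derivative_iff)
      then show False using nd real_differentiable_def by blast
    qed
  qed
qed

text \<open>Disjoint intervals of slope at most \<open>\<eta>\<close> cover almost all of
  \<open>{a..b}\<close> and contribute at most \<eta> (b - a) to the total increment. The gaps have
  measure so small that absolute continuity bounds their contribution by
  \<open>\<eta>\<close>.\<close>

lemma AC_on_zero_derivative_imp_const: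
  assumes f: "AC_on a b f" and "a < b"
    and N: "negligible {x \<in> {a<..<b}. \<not> (f has_real_derivative 0) (at x)}"
  shows "f b = f a"
proof -
  define N where "N = {x \<in> {a<..<b}. \<not> (f has_real_derivative 0) (at x)}"
  define E where "E = {a<..<b} - N"
  have nN: "N \<in> null_sets lebesgue" using N by (simp add: N_def negligible_iff_null_sets)
  have sE: "E \<in> sets lebesgue" using nN by (auto simp: E_def)
  have "{a, b} \<in> null_sets lebesgue" by (simp flip: negligible_iff_null_sets)
  then have nN': "N \<union> {a, b} \<in> null_sets lebesgue" using nN by (intro null_sets.Un)
  have bound: "\<bar>f b - f a\<bar> \<le> \<eta> * (b - a + 1)" if "\<eta> > 0" for \<eta>
  proof -
    obtain \<delta> where "\<delta> > 0" and \<delta>: "\<And>D S. \<lbrakk>D division_of S; S \<subseteq> {a..b}; measure lebesgue S < \<delta>\<rbrakk>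
       \<Longrightarrow> (\<Sum>k\<in>D. \<bar>increment f k\<bar>) < \<eta>"
      using AC_on_divisionE[OF f \<open>\<eta> > 0\<close>] by blast
    obtain D where D: "D division_of \<Union>D"
      and Dv: "\<And>k. k \<in> D \<Longrightarrow> \<exists>u v. u < v \<and> k = {u..v} \<and> {u..v} \<subseteq> {a..b} \<and> \<bar>f v - f u\<bar> \<le> \<eta> * (v - u)"
      and DE: "measure lebesgue (E - \<Union>D) < \<delta>"
    proof (rule Vitali_covering_intervals[OF sE \<open>\<delta> > 0\<close>,
          of "\<lambda>u v. {u..v} \<subseteq> {a..b} \<and> \<bar>f v - f u\<bar> \<le> \<eta> * (v - u)" a b])
      fix x d :: real assume "x \<in> E" "0 < d"
      then have x: "x \<in> {a<..<b}" and "(f has_real_derivative 0) (at x)" by (auto simp: E_def N_def)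
      then have "((\<lambda>y. (f y - f x) / (y - x)) \<longlongrightarrow> 0) (at x)" by (simp add: has_field_derivative_iff)
      then have "\<forall>\<^sub>F y in at x. \<bar>(f y - f x) / (y - x)\<bar> < \<eta>"
        using \<open>\<eta> > 0\<close> by (auto dest!: tendstoD simp: dist_real_def)
      then have fr: "\<exists>\<^sub>F y in at x. \<bar>(f y - f x) / (y - x)\<bar> < \<eta>"
        by (rule eventually_frequently[rotated]) simp
      obtain r where r: "r > 0" "ball x r \<subseteq> {a<..<b}"
        using x by (meson open_contains_ball open_greaterThanLessThan)
      from frequently_slope_interval[where P = "\<lambda>z. \<bar>z\<bar> < \<eta>", OF fr, of "min d r"] r \<open>0 < d\<close>
      obtain u v where uv: "u < v" "x \<in> {u..v}" "v - u < min d r" "\<bar>(f v - f u) / (v - u)\<bar> < \<eta>"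
        by auto
      have "{u..v} \<subseteq> ball x r" using uv by (auto simp: dist_real_def)
      then have "{u..v} \<subseteq> {a..b}" using r(2) by (force simp: subset_iff)
      moreover have "\<bar>f v - f u\<bar> \<le> \<eta> * (v - u)" using uv by (simp add: abs_divide field_simps)
      ultimately show "\<exists>u v. u < v \<and> x \<in> {u..v} \<and> v - u < d \<and> {u..v} \<subseteq> {a..b} \<and> \<bar>f v - f u\<bar> \<le> \<eta> * (v - u)"
        using uv by (intro exI[of _ u] exI[of _ v]) simp
    next
      fix u v assume "{u..v} \<subseteq> {a..b} \<and> \<bar>f v - f u\<bar> \<le> \<eta> * (v - u)"
      then show "{u..v} \<subseteq> {a..b}" ..
    qed blast
    have sub: "\<Union>D \<subseteq> {a..b}" using Dv by (intro Union_least) metis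
    have mD: "\<Union>D \<in> lmeasurable" using D lmeasurable_division by blast
    \<comment> \<open>\<open>Q - D\<close> consists of the gaps between the flat intervals;
      \<open>N\<close> and the two endpoints add nothing to their measure.\<close>
    obtain Q where Q: "D \<subseteq> Q" "Q division_of {a..b}"
      using partial_division_extend_interval[of D a b] D sub by auto
    have finQ: "finite Q" using Q(2) by blast
    have div': "Q - D division_of \<Union>(Q - D)"
      by (rule division_of_subset[of Q]) (use Q in auto)
    have "measure lebesgue (\<Union>(Q - D)) = measure lebesgue {a..b} - measure lebesgue (\<Union>D)"
      using sum.subset_diff[OF Q(1) finQ, of "measure lebesgue"]
        content_division[OF Q(2)] content_division[OF D] content_division[OF div'] by simp
    also have "\<dots> = measure lebesgue ({a..b} - \<Union>D)"
      using mD sub by (intro measurable_measure_Diff[symmetric]) (auto dest: fmeasurableD)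
    also have "\<dots> \<le> measure lebesgue ((E - \<Union>D) \<union> (N \<union> {a, b}))"
    proof (rule measure_mono_fmeasurable)
      show "{a..b} - \<Union>D \<subseteq> (E - \<Union>D) \<union> (N \<union> {a, b})" by (auto simp: E_def)
      show "{a..b} - \<Union>D \<in> sets lebesgue" using mD by (auto dest: fmeasurableD)
      have "E \<in> lmeasurable" using sE by (intro bounded_lmeasurable[of E a b]) (auto simp: E_def)
      then show "(E - \<Union>D) \<union> (N \<union> {a, b}) \<in> lmeasurable"
        by (rule fmeasurable.Un[OF fmeasurable_Diff[OF _ fmeasurableD[OF mD]] fmeasurableI_null_sets[OF nN']])
    qed
    also have "\<dots> = measure lebesgue (E - \<Union>D)"
    proof (rule measure_Un_null_set)
      show "E - \<Union>D \<in> sets lebesgue" using sE mD by (auto dest: fmeasurableD)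
      show "N \<union> {a, b} \<in> null_sets lebesgue" by (rule nN')
    qed
    also have "\<dots> < \<delta>" by (rule DE)
    finally have rest: "(\<Sum>k\<in>Q - D. \<bar>increment f k\<bar>) < \<eta>"
      by (intro \<delta>[OF div']) (use division_ofD(6)[OF Q(2)] in auto)
    have "(\<Sum>k\<in>D. \<bar>increment f k\<bar>) \<le> (\<Sum>k\<in>D. \<eta> * measure lebesgue k)"
    proof (rule sum_mono)
      fix k assume "k \<in> D"
      from Dv[OF this] show "\<bar>increment f k\<bar> \<le> \<eta> * measure lebesgue k" by auto
    qed
    also have "\<dots> = \<eta> * measure lebesgue (\<Union>D)"
      unfolding content_division[OF D, symmetric] by (rule sum_distrib_left[symmetric])
    also have "\<dots> \<le> \<eta> * measure lebesgue {a..b}"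
      using \<open>\<eta> > 0\<close> sub mD by (intro mult_left_mono measure_mono_fmeasurable) (auto dest: fmeasurableD)
    also have "\<dots> = \<eta> * (b - a)" using \<open>a < b\<close> by simp
    finally have large: "(\<Sum>k\<in>D. \<bar>increment f k\<bar>) \<le> \<eta> * (b - a)" .
    have "f b - f a = (\<Sum>k\<in>Q. increment f k)"
      using sum_increment_division[OF _ Q(2)] \<open>a < b\<close> by simp
    then have "\<bar>f b - f a\<bar> \<le> (\<Sum>k\<in>Q. \<bar>increment f k\<bar>)" by (simp add: sum_abs)
    also have "\<dots> = (\<Sum>k\<in>Q - D. \<bar>increment f k\<bar>) + (\<Sum>k\<in>D. \<bar>increment f k\<bar>)"
      by (rule sum.subset_diff[OF Q(1) finQ])
    finally show ?thesis using rest large by (simp add: algebra_simps)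
  qed
  have "\<bar>f b - f a\<bar> \<le> 0"
  proof (rule field_le_epsilon)
    fix e :: real assume "e > 0"
    define c where "c = b - a + 1"
    have "c > 0" using \<open>a < b\<close> by (simp add: c_def)
    then show "\<bar>f b - f a\<bar> \<le> 0 + e" using bound[of "e / c", folded c_def] \<open>e > 0\<close> by simp
  qed
  then show ?thesis by simp
qed

section \<open>The inner product space W\<close>

lemma AC_on_cong:
  assumes "\<And>t. t \<in> {a..b} \<Longrightarrow> f t = h t"
  shows "AC_on a b f \<longleftrightarrow> AC_on a b h"
proof -
  have "(\<Sum>(u, v)\<in>I. \<bar>f v - f u\<bar>) = (\<Sum>(u, v)\<in>I. \<bar>h v - h u\<bar>)"
    if "\<forall>(u, v) \<in> I. a \<le> u \<and> u \<le> v \<and> v \<le> b" for I :: "(real \<times> real) set"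
    using that assms by (intro sum.cong refl) fastforce
  then show ?thesis unfolding AC_on_def by (metis (no_types, lifting))
qed

lemma AC_on_subinterval:
  assumes "AC_on a b f" "a \<le> a'" "b' \<le> b"
  shows "AC_on a' b' f"
  unfolding AC_on_def
proof (intro allI impI)
  fix \<epsilon> :: real assume "\<epsilon> > 0"
  then obtain \<delta> where "\<delta> > 0" and \<delta>: "\<forall>I :: (real \<times> real) set.
       finite I \<and> (\<forall>(u, v) \<in> I. a \<le> u \<and> u \<le> v \<and> v \<le> b) \<and>
       pairwise (\<lambda>p q. disjnt {fst p<..<snd p} {fst q<..<snd q}) I \<and>
       (\<Sum>(u, v)\<in>I. v - u) < \<delta> \<longrightarrow> (\<Sum>(u, v)\<in>I. \<bar>f v - f u\<bar>) < \<epsilon>"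
    using assms(1) unfolding AC_on_def by blast
  show "\<exists>\<delta>>0. \<forall>I :: (real \<times> real) set.
       finite I \<and> (\<forall>(u, v) \<in> I. a' \<le> u \<and> u \<le> v \<and> v \<le> b') \<and>
       pairwise (\<lambda>p q. disjnt {fst p<..<snd p} {fst q<..<snd q}) I \<and>
       (\<Sum>(u, v)\<in>I. v - u) < \<delta> \<longrightarrow> (\<Sum>(u, v)\<in>I. \<bar>f v - f u\<bar>) < \<epsilon>"
  proof (intro exI[of _ \<delta>] conjI allI impI \<open>\<delta> > 0\<close>)
    fix I :: "(real \<times> real) set"
    assume I: "finite I \<and> (\<forall>(u, v) \<in> I. a' \<le> u \<and> u \<le> v \<and> v \<le> b') \<and>
       pairwise (\<lambda>p q. disjnt {fst p<..<snd p} {fst q<..<snd q}) I \<and> (\<Sum>(u, v)\<in>I. v - u) < \<delta>"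
    then have "\<forall>(u, v) \<in> I. a \<le> u \<and> u \<le> v \<and> v \<le> b"
      using assms(2,3) by fastforce
    then show "(\<Sum>(u, v)\<in>I. \<bar>f v - f u\<bar>) < \<epsilon>" using \<delta> I by blast
  qed
qed

lemma AC_on_lincomb:
  assumes "AC_on a b f" "AC_on a b h"
  shows "AC_on a b (\<lambda>t. \<alpha> * f t + \<beta> * h t)"
  unfolding AC_on_def
proof (intro allI impI)
  fix \<epsilon> :: real assume "\<epsilon> > 0"
  \<comment> \<open>The summand 1 keeps \<open>c\<close> positive when both coefficients vanish and
    makes the final estimate strict.\<close>
  define c where "c = 1 + \<bar>\<alpha>\<bar> + \<bar>\<beta>\<bar>"
  have c: "c > 0" "\<bar>\<alpha>\<bar> + \<bar>\<beta>\<bar> < c" by (auto simp: c_def)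
  have e: "\<epsilon> / c > 0" using \<open>\<epsilon> > 0\<close> c by simp
  obtain \<delta>1 where "\<delta>1 > 0" and \<delta>1: "\<forall>I :: (real \<times> real) set.
       finite I \<and> (\<forall>(u, v) \<in> I. a \<le> u \<and> u \<le> v \<and> v \<le> b) \<and>
       pairwise (\<lambda>p q. disjnt {fst p<..<snd p} {fst q<..<snd q}) I \<and>
       (\<Sum>(u, v)\<in>I. v - u) < \<delta>1 \<longrightarrow> (\<Sum>(u, v)\<in>I. \<bar>f v - f u\<bar>) < \<epsilon> / c"
    using assms(1) e unfolding AC_on_def by meson
  obtain \<delta>2 where "\<delta>2 > 0" and \<delta>2: "\<forall>I :: (real \<times> real) set.
       finite I \<and> (\<forall>(u, v) \<in> I. a \<le> u \<and> u \<le> v \<and> v \<le> b) \<and>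
       pairwise (\<lambda>p q. disjnt {fst p<..<snd p} {fst q<..<snd q}) I \<and>
       (\<Sum>(u, v)\<in>I. v - u) < \<delta>2 \<longrightarrow> (\<Sum>(u, v)\<in>I. \<bar>h v - h u\<bar>) < \<epsilon> / c"
    using assms(2) e unfolding AC_on_def by meson
  show "\<exists>\<delta>>0. \<forall>I :: (real \<times> real) set.
       finite I \<and> (\<forall>(u, v) \<in> I. a \<le> u \<and> u \<le> v \<and> v \<le> b) \<and>
       pairwise (\<lambda>p q. disjnt {fst p<..<snd p} {fst q<..<snd q}) I \<and>
       (\<Sum>(u, v)\<in>I. v - u) < \<delta> \<longrightarrow>
       (\<Sum>(u, v)\<in>I. \<bar>(\<alpha> * f v + \<beta> * h v) - (\<alpha> * f u + \<beta> * h u)\<bar>) < \<epsilon>"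
  proof (intro exI[of _ "min \<delta>1 \<delta>2"] conjI allI impI)
    show "min \<delta>1 \<delta>2 > 0" using \<open>\<delta>1 > 0\<close> \<open>\<delta>2 > 0\<close> by simp
    fix I :: "(real \<times> real) set"
    assume "finite I \<and> (\<forall>(u, v) \<in> I. a \<le> u \<and> u \<le> v \<and> v \<le> b) \<and>
       pairwise (\<lambda>p q. disjnt {fst p<..<snd p} {fst q<..<snd q}) I \<and>
       (\<Sum>(u, v)\<in>I. v - u) < min \<delta>1 \<delta>2"
    then have F: "(\<Sum>(u, v)\<in>I. \<bar>f v - f u\<bar>) < \<epsilon> / c" and H: "(\<Sum>(u, v)\<in>I. \<bar>h v - h u\<bar>) < \<epsilon> / c"
      using \<delta>1 \<delta>2 by auto
    have "(\<Sum>(u, v)\<in>I. \<bar>(\<alpha> * f v + \<beta> * h v) - (\<alpha> * f u + \<beta> * h u)\<bar>)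
        \<le> (\<Sum>(u, v)\<in>I. \<bar>\<alpha>\<bar> * \<bar>f v - f u\<bar> + \<bar>\<beta>\<bar> * \<bar>h v - h u\<bar>)"
    proof (rule sum_mono, clarify)
      fix u v
      have "(\<alpha> * f v + \<beta> * h v) - (\<alpha> * f u + \<beta> * h u) = \<alpha> * (f v - f u) + \<beta> * (h v - h u)"
        by (simp add: algebra_simps)
      then show "\<bar>(\<alpha> * f v + \<beta> * h v) - (\<alpha> * f u + \<beta> * h u)\<bar> \<le> \<bar>\<alpha>\<bar> * \<bar>f v - f u\<bar> + \<bar>\<beta>\<bar> * \<bar>h v - h u\<bar>"
        by (metis abs_mult abs_triangle_ineq)
    qed
    also have "\<dots> = \<bar>\<alpha>\<bar> * (\<Sum>(u, v)\<in>I. \<bar>f v - f u\<bar>) + \<bar>\<beta>\<bar> * (\<Sum>(u, v)\<in>I. \<bar>h v - h u\<bar>)"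
      by (simp add: case_prod_unfold sum.distrib sum_distrib_left)
    also have "\<dots> \<le> \<bar>\<alpha>\<bar> * (\<epsilon> / c) + \<bar>\<beta>\<bar> * (\<epsilon> / c)"
      using F H by (intro add_mono mult_left_mono) auto
    also have "\<dots> = (\<bar>\<alpha>\<bar> + \<bar>\<beta>\<bar>) * (\<epsilon> / c)" by (rule distrib_right[symmetric])
    also have "\<dots> < c * (\<epsilon> / c)" using c(2) e by (rule mult_strict_right_mono)
    also have "\<dots> = \<epsilon>" using c by simp
    finally show "(\<Sum>(u, v)\<in>I. \<bar>(\<alpha> * f v + \<beta> * h v) - (\<alpha> * f u + \<beta> * h u)\<bar>) < \<epsilon>" .
  qed
qed

section \<open>Derivatives relative to the closed interval\<close>

lemma D1_eqI:
  assumes "a < b" "t \<in> {a..b}" "(f has_real_derivative d) (at t within {a..b})"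
  shows "D1 a b f t = d"
  unfolding D1_def using assms
  by (intro vector_derivative_within_closed_interval)
     (auto simp: has_real_derivative_iff_has_vector_derivative)

lemma has_real_derivative_D1:
  assumes "f differentiable (at t within {a..b})"
  shows "(f has_real_derivative D1 a b f t) (at t within {a..b})"
  using assms unfolding D1_def has_real_derivative_iff_has_vector_derivative
  by (simp add: vector_derivative_works)

lemma D1_lincomb:
  assumes "a < b" "t \<in> {a..b}" "f differentiable (at t within {a..b})" "h differentiable (at t within {a..b})"
  shows "D1 a b (\<lambda>t. \<alpha> * f t + \<beta> * h t) t = \<alpha> * D1 a b f t + \<beta> * D1 a b h t"
  using has_real_derivative_D1[OF assms(3)] has_real_derivative_D1[OF assms(4)]
  by (intro D1_eqI[OF assms(1,2)] DERIV_add DERIV_cmult)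

lemma D1_cong:
  assumes "\<And>t. t \<in> {a..b} \<Longrightarrow> f t = h t" "t \<in> {a..b}"
  shows "D1 a b f t = D1 a b h t"
  unfolding D1_def
  by (rule vector_derivative_cong_eq) (use assms in \<open>auto intro!: always_eventually\<close>)

lemma AC_on_differentiable_AE:
  assumes "AC_on a b f"
  shows "AE t in lebesgue. t \<in> {a..b} \<longrightarrow> f differentiable (at t within {a..b})"
proof -
  have "{x \<in> {a<..<b}. \<not> f differentiable at x} \<union> {a, b} \<in> null_sets lebesgue"
    using negligible_not_differentiable_AC_on[OF assms] by (simp flip: negligible_iff_null_sets)
  then show ?thesis
    by (rule AE_I') (use differentiable_at_withinI in fastforce)
qed

lemma W_D:
  assumes "f \<in> W a b"
  shows "\<And>t. t \<notin> {a..b} \<Longrightarrow> f t = 0" "L2_on a b f" "f a = 0" "f b = 0" "AC_on a b f"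
    "\<And>t. t \<in> {a..b} \<Longrightarrow> f differentiable (at t within {a..b})"
    "AC_on a b (D1 a b f)" "L2_on a b (D2 a b f)"
  using assms unfolding W_def differentiable_on_def by blast+

text \<open>First derivatives exist on all of \<open>{a..b}\<close>, so \<open>D1\<close> is linear
  there pointwise. Second derivatives exist only almost everywhere; elsewhere \<open>D2\<close> has
  unspecified values, for which linearity may fail.\<close>

lemma D2_lincomb_AE:
  assumes "a < b" "f \<in> W a b" "h \<in> W a b"
  shows "AE t in lebesgue. t \<in> {a..b} \<longrightarrow>
    D2 a b (\<lambda>t. \<alpha> * f t + \<beta> * h t) t = \<alpha> * D2 a b f t + \<beta> * D2 a b h t"
proof -
  have D: "D1 a b (\<lambda>t. \<alpha> * f t + \<beta> * h t) t = \<alpha> * D1 a b f t + \<beta> * D1 a b h t"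
    if "t \<in> {a..b}" for t
    using D1_lincomb[OF assms(1) that W_D(6)[OF assms(2) that] W_D(6)[OF assms(3) that]] .
  show ?thesis
    using AC_on_differentiable_AE[OF W_D(7)[OF assms(2)]] AC_on_differentiable_AE[OF W_D(7)[OF assms(3)]]
  proof eventually_elim
    case (elim t)
    show ?case
    proof
      assume t: "t \<in> {a..b}"
      then show "D2 a b (\<lambda>t. \<alpha> * f t + \<beta> * h t) t = \<alpha> * D2 a b f t + \<beta> * D2 a b h t"
        unfolding D2_def using elim D1_lincomb[OF assms(1) t] by (subst D1_cong[OF D t]) auto
    qed
  qed
qed

section \<open>Square-integrable functions\<close>

lemma L2_on_lincomb:
  assumes f: "L2_on a b f" and h: "L2_on a b h"
    and g: "AE t in lebesgue. t \<in> {a..b} \<longrightarrow> g t = \<alpha> * f t + \<beta> * h t"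
  shows "L2_on a b g"
proof -
  let ?i = "indicator {a..b} :: real \<Rightarrow> real"
  have mf [measurable]: "(\<lambda>t. ?i t * f t) \<in> borel_measurable lebesgue"
    and mh [measurable]: "(\<lambda>t. ?i t * h t) \<in> borel_measurable lebesgue"
    and f2: "integrable lebesgue (\<lambda>t. ?i t * (f t)\<^sup>2)" and h2: "integrable lebesgue (\<lambda>t. ?i t * (h t)\<^sup>2)"
    using f h unfolding L2_on_def set_borel_measurable_def set_integrable_def by auto
  have eq: "AE t in lebesgue. \<alpha> * (?i t * f t) + \<beta> * (?i t * h t) = ?i t * g t"
    using g by eventually_elim (auto simp: indicator_def)
  \<comment> \<open>Measurability passes through an almost everywhere equality because Lebesgue
    measure is complete.\<close>
  have mg [measurable]: "(\<lambda>t. ?i t * g t) \<in> borel_measurable lebesgue"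
    by (rule borel_measurable_AE[OF _ eq]) measurable
  have mg2: "(\<lambda>t. ?i t * (g t)\<^sup>2) \<in> borel_measurable lebesgue"
  proof -
    have "(\<lambda>t. (?i t * g t)\<^sup>2) \<in> borel_measurable lebesgue" by measurable
    also have "(\<lambda>t. (?i t * g t)\<^sup>2) = (\<lambda>t. ?i t * (g t)\<^sup>2)" by (auto simp: indicator_def)
    finally show ?thesis .
  qed
  have "integrable lebesgue (\<lambda>t. ?i t * (g t)\<^sup>2)"
  proof (rule Bochner_Integration.integrable_bound[OF _ mg2])
    show "integrable lebesgue (\<lambda>t. 2 * \<alpha>\<^sup>2 * (?i t * (f t)\<^sup>2) + 2 * \<beta>\<^sup>2 * (?i t * (h t)\<^sup>2))"
      using f2 h2 by (intro Bochner_Integration.integrable_add integrable_mult_right) auto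
    show "AE t in lebesgue. norm (?i t * (g t)\<^sup>2) \<le> norm (2 * \<alpha>\<^sup>2 * (?i t * (f t)\<^sup>2) + 2 * \<beta>\<^sup>2 * (?i t * (h t)\<^sup>2))"
      using g
    proof eventually_elim
      case (elim t)
      have "(\<alpha> * f t + \<beta> * h t)\<^sup>2 \<le> 2 * \<alpha>\<^sup>2 * (f t)\<^sup>2 + 2 * \<beta>\<^sup>2 * (h t)\<^sup>2"
        using zero_le_power2[of "\<alpha> * f t - \<beta> * h t"] by (simp add: power2_eq_square algebra_simps)
      then show ?case using elim by (auto simp: indicator_def)
    qed
  qed
  then show ?thesis
    using mg by (simp add: L2_on_def set_borel_measurable_def set_integrable_def)
qed

lemma L2_on_cong:
  assumes "L2_on a b f" "\<And>t. t \<in> {a..b} \<Longrightarrow> g t = f t"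
  shows "L2_on a b g"
  using L2_on_lincomb[OF assms(1,1), of g 1 0] assms(2) by simp

lemma L2_on_mult_integrable:
  assumes f: "L2_on a b f" and h: "L2_on a b h"
  shows "set_integrable lebesgue {a..b} (\<lambda>t. f t * h t)"
proof -
  let ?i = "indicator {a..b} :: real \<Rightarrow> real"
  have mf [measurable]: "(\<lambda>t. ?i t * f t) \<in> borel_measurable lebesgue"
    and mh [measurable]: "(\<lambda>t. ?i t * h t) \<in> borel_measurable lebesgue"
    and f2: "integrable lebesgue (\<lambda>t. ?i t * (f t)\<^sup>2)" and h2: "integrable lebesgue (\<lambda>t. ?i t * (h t)\<^sup>2)"
    using f h unfolding L2_on_def set_borel_measurable_def set_integrable_def by auto
  have m: "(\<lambda>t. ?i t * (f t * h t)) \<in> borel_measurable lebesgue"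
  proof -
    have "(\<lambda>t. (?i t * f t) * (?i t * h t)) \<in> borel_measurable lebesgue" by measurable
    also have "(\<lambda>t. (?i t * f t) * (?i t * h t)) = (\<lambda>t. ?i t * (f t * h t))" by (auto simp: indicator_def)
    finally show ?thesis .
  qed
  have "integrable lebesgue (\<lambda>t. ?i t * (f t * h t))"
  proof (rule Bochner_Integration.integrable_bound[OF Bochner_Integration.integrable_add[OF f2 h2] m], rule AE_I2)
    fix t
    \<comment> \<open>Expanding (\<bar>f\<bar> - \<bar>h\<bar>)^2 \<ge> 0 bounds twice the product;
      its nonnegativity allows dropping one copy.\<close>
    have "\<bar>f t * h t\<bar> \<le> (f t)\<^sup>2 + (h t)\<^sup>2"
      using zero_le_power2[of "\<bar>f t\<bar> - \<bar>h t\<bar>"] mult_nonneg_nonneg[OF abs_ge_zero abs_ge_zero, of "f t" "h t"]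
      unfolding power2_diff abs_mult power2_abs by linarith
    then show "norm (?i t * (f t * h t)) \<le> norm (?i t * (f t)\<^sup>2 + ?i t * (h t)\<^sup>2)"
      by (auto simp: indicator_def)
  qed
  then show ?thesis by (simp add: set_integrable_def)
qed

section \<open>Vector space structure and inner product of W\<close>

lemma W_lincomb:
  assumes "a < b" "f \<in> W a b" "h \<in> W a b"
  shows "(\<lambda>t. \<alpha> * f t + \<beta> * h t) \<in> W a b"
proof -
  let ?g = "\<lambda>t. \<alpha> * f t + \<beta> * h t"
  have D: "\<alpha> * D1 a b f t + \<beta> * D1 a b h t = D1 a b ?g t" if "t \<in> {a..b}" for t
    using D1_lincomb[OF assms(1) that W_D(6)[OF assms(2) that] W_D(6)[OF assms(3) that]] by simp
  have "AC_on a b (D1 a b ?g)"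
    using AC_on_lincomb[OF W_D(7)[OF assms(2)] W_D(7)[OF assms(3)], of \<alpha> \<beta>]
      AC_on_cong[of a b "\<lambda>t. \<alpha> * D1 a b f t + \<beta> * D1 a b h t" "D1 a b ?g", OF D] by simp
  moreover have "L2_on a b (D2 a b ?g)"
    by (rule L2_on_lincomb[OF W_D(8)[OF assms(2)] W_D(8)[OF assms(3)] D2_lincomb_AE[OF assms]])
  moreover have "L2_on a b ?g"
    by (rule L2_on_lincomb[OF W_D(2)[OF assms(2)] W_D(2)[OF assms(3)], of _ \<alpha> \<beta>]) simp
  moreover have "?g differentiable_on {a..b}"
    using W_D(6)[OF assms(2)] W_D(6)[OF assms(3)] unfolding differentiable_on_def
    by (intro ballI differentiable_add differentiable_mult differentiable_const) auto
  ultimately show ?thesis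
    using AC_on_lincomb[OF W_D(5)[OF assms(2)] W_D(5)[OF assms(3)]]
      W_D(1)[OF assms(2)] W_D(1)[OF assms(3)] W_D(3,4)[OF assms(2)] W_D(3,4)[OF assms(3)]
    by (simp add: W_def)
qed

lemma W_zero:
  assumes "a < b"
  shows "(\<lambda>_. 0) \<in> W a b"
proof -
  have D: "D1 a b h t = 0" if "\<And>t. t \<in> {a..b} \<Longrightarrow> h t = 0" "t \<in> {a..b}" for h t
    using D1_cong[of a b h "\<lambda>_. 0" t] D1_eqI[OF assms, of t "\<lambda>_. 0" 0] that by simp
  have AC: "AC_on a b (\<lambda>_. 0)" unfolding AC_on_def by (auto intro: zero_less_one)
  have L2: "L2_on a b (\<lambda>_. 0)" by (simp add: L2_on_def set_borel_measurable_def)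
  have D1: "D1 a b (\<lambda>_. 0) t = 0" if "t \<in> {a..b}" for t using D[OF _ that, of "\<lambda>_. 0"] by simp
  have D2: "D2 a b (\<lambda>_. 0) t = 0" if "t \<in> {a..b}" for t unfolding D2_def by (rule D[OF D1 that])
  show ?thesis
    using AC AC_on_cong[OF D1] L2 L2_on_cong[OF L2 D2] by (simp add: W_def)
qed

lemma W_inner_commute: "W_inner a b f h = W_inner a b h f"
  by (simp add: W_inner_def mult.commute)

lemma W_inner_lincomb_left:
  assumes "a < b" "f \<in> W a b" "h \<in> W a b" "g \<in> W a b"
  shows "W_inner a b (\<lambda>t. \<alpha> * f t + \<beta> * h t) g = \<alpha> * W_inner a b f g + \<beta> * W_inner a b h g"
proof -
  let ?k = "\<lambda>t. \<alpha> * f t + \<beta> * h t"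
  have i: "set_integrable lebesgue {a..b} (\<lambda>t. D2 a b u t * D2 a b g t)" if "u \<in> W a b" for u
    using L2_on_mult_integrable[OF W_D(8)[OF that] W_D(8)[OF assms(4)]] .
  have ifh: "set_integrable lebesgue {a..b} (\<lambda>t. \<alpha> * (D2 a b f t * D2 a b g t))"
    "set_integrable lebesgue {a..b} (\<lambda>t. \<beta> * (D2 a b h t * D2 a b g t))"
    using i[OF assms(2)] i[OF assms(3)] by simp_all
  have "W_inner a b ?k g = (LINT t:{a..b}|lebesgue. \<alpha> * (D2 a b f t * D2 a b g t) + \<beta> * (D2 a b h t * D2 a b g t))"
    unfolding W_inner_def set_lebesgue_integral_def
  proof (rule integral_cong_AE)
    show "AE t in lebesgue. indicator {a..b} t *\<^sub>R (D2 a b ?k t * D2 a b g t) =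
        indicator {a..b} t *\<^sub>R (\<alpha> * (D2 a b f t * D2 a b g t) + \<beta> * (D2 a b h t * D2 a b g t))"
      using D2_lincomb_AE[OF assms(1-3), of \<alpha> \<beta>]
      by eventually_elim (auto simp: indicator_def algebra_simps)
  qed (use i[OF W_lincomb[OF assms(1-3)]] set_integral_add(1)[OF ifh] in
      \<open>simp_all only: set_integrable_def borel_measurable_integrable\<close>)
  also have "\<dots> = \<alpha> * W_inner a b f g + \<beta> * W_inner a b h g"
    unfolding W_inner_def using set_integral_add(2)[OF ifh] by simp
  finally show ?thesis .
qed

lemma W_inner_nonneg: "W_inner a b f f \<ge> 0"
  unfolding W_inner_def set_lebesgue_integral_def by (intro integral_nonneg_AE) simp

text \<open>A vanishing inner product makes the second derivative zero almost everywhere. The first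
  derivative is absolutely continuous, hence constant, so \<open>f\<close> is affine on
  \<open>{a..b}\<close>, and the boundary conditions leave only zero.\<close>

lemma W_inner_definite:
  assumes "a < b" "f \<in> W a b" "W_inner a b f f = 0"
  shows "f = (\<lambda>_. 0)"
proof -
  let ?g = "D1 a b f"
  have "integrable lebesgue (\<lambda>t. indicator {a..b} t * (D2 a b f t * D2 a b f t))"
    using L2_on_mult_integrable[OF W_D(8)[OF assms(2)] W_D(8)[OF assms(2)]] by (simp add: set_integrable_def)
  then have "AE t in lebesgue. indicator {a..b} t * (D2 a b f t * D2 a b f t) = 0"
    using assms(3) integral_nonneg_eq_0_iff_AE[of lebesgue "\<lambda>t. indicator {a..b} t * (D2 a b f t * D2 a b f t)"]
    by (simp add: W_inner_def set_lebesgue_integral_def)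
  then have "AE t in lebesgue. t \<in> {a<..<b} \<longrightarrow> (?g has_real_derivative 0) (at t)"
    using AC_on_differentiable_AE[OF W_D(7)[OF assms(2)]]
  proof eventually_elim
    case (elim t)
    show ?case
    proof
      assume t: "t \<in> {a<..<b}"
      then have "D1 a b ?g t = 0" using elim(1) by (simp add: D2_def)
      moreover have "?g differentiable (at t within {a..b})" using elim(2) t by auto
      ultimately have "(?g has_real_derivative 0) (at t within {a..b})"
        using has_real_derivative_D1 by metis
      then show "(?g has_real_derivative 0) (at t)"
        using t at_within_interior[of t "{a..b}"] by simp
    qed
  qed
  then have null: "negligible {x \<in> {a<..<b}. \<not> (?g has_real_derivative 0) (at x)}"
  proof (rule AE_E)
    fix N assume N: "{x \<in> space lebesgue. \<not> (x \<in> {a<..<b} \<longrightarrow> (?g has_real_derivative 0) (at x))} \<subseteq> N"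
      and "emeasure lebesgue N = 0" "N \<in> sets lebesgue"
    then have "negligible N" by (simp add: negligible_iff_null_sets null_setsI)
    then show ?thesis
      by (rule negligible_subset) (use N in \<open>simp add: subset_iff\<close>)
  qed
  \<comment> \<open>The constancy lemma compares the two endpoints of an interval, so it is applied
    to \<open>{a..t}\<close> for each \<open>t\<close>.\<close>
  have const: "?g t = ?g a" if "t \<in> {a..b}" for t
  proof (cases "t = a")
    case False
    with that have "a < t" "t \<le> b" by auto
    show ?thesis
      by (rule AC_on_zero_derivative_imp_const[OF AC_on_subinterval[OF W_D(7)[OF assms(2)]] \<open>a < t\<close> negligible_subset[OF null]])
         (use \<open>t \<le> b\<close> in auto)
  qed simp
  define c where "c = ?g a"
  have "((\<lambda>t. f t - c * t) has_real_derivative 0) (at t within {a..b})" if "t \<in> {a..b}" for t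
  proof -
    have "(f has_real_derivative c) (at t within {a..b})"
      using has_real_derivative_D1[OF W_D(6)[OF assms(2) that]] const[OF that] by (simp add: c_def)
    then show ?thesis by (auto intro!: derivative_eq_intros)
  qed
  then obtain d where d: "\<And>t. t \<in> {a..b} \<Longrightarrow> f t - c * t = d"
    using has_field_derivative_zero_constant[of "{a..b}" "\<lambda>t. f t - c * t"] by auto
  \<comment> \<open>The affine function c t + d vanishes at the two distinct points \<open>a\<close>
    and \<open>b\<close>.\<close>
  have "d = - c * a" "d = - c * b" using d[of a] d[of b] \<open>a < b\<close> W_D(3,4)[OF assms(2)] by auto
  then have "c = 0" "d = 0" using \<open>a < b\<close> by auto
  then show ?thesis using d W_D(1)[OF assms(2)] by (intro ext) force
qed

lemma W_sum:
  fixes N :: nat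
  assumes "a < b" "\<And>j. j < N \<Longrightarrow> f j \<in> W a b"
  shows "(\<lambda>t. \<Sum>j<N. c j * f j t) \<in> W a b"
  using assms(2)
proof (induction N)
  case 0
  then show ?case using W_zero[OF assms(1)] by simp
next
  case (Suc N)
  then show ?case using W_lincomb[OF assms(1), of "\<lambda>t. \<Sum>j<N. c j * f j t" "f N" 1 "c N"] by simp
qed

lemma W_inner_sum_left:
  fixes N :: nat
  assumes "a < b" "\<And>j. j < N \<Longrightarrow> f j \<in> W a b" "g \<in> W a b"
  shows "W_inner a b (\<lambda>t. \<Sum>j<N. c j * f j t) g = (\<Sum>j<N. c j * W_inner a b (f j) g)"
  using assms(2)
proof (induction N)
  case 0
  \<comment> \<open>The empty sum is the zero function, written as 0 g + 0 g.\<close>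
  then show ?case using W_inner_lincomb_left[OF assms(1,3,3,3), of 0 0] by simp
next
  case (Suc N)
  then have "(\<lambda>t. \<Sum>j<N. c j * f j t) \<in> W a b" by (intro W_sum[OF assms(1)]) auto
  then show ?case
    using W_inner_lincomb_left[OF assms(1) _ _ assms(3), of "\<lambda>t. \<Sum>j<N. c j * f j t" "f N" 1 "c N"] Suc by simp
qed

section \<open>The singular system of an operator from its Gram matrix\<close>

text \<open>Isolates the Hilbert space argument from the kernels: on \<open>W a b\<close> every
  component of \<open>K f\<close> is an inner product with a representer. The dimension of
  \<open>K f\<close> is assumed for all \<open>f\<close>, so vector operations on it raise no
  membership questions.\<close>

locale gram_spectral_system =
  fixes a b :: real and N :: nat and K :: "(real \<Rightarrow> real) \<Rightarrow> real vec"
    and \<eta> v :: "nat \<Rightarrow> real \<Rightarrow> real" and U :: "real mat" and lam :: "nat \<Rightarrow> real"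
  assumes less: "a < b"
    and K_carrier: "\<And>f. K f \<in> carrier_vec N"
    and riesz: "riesz_representers a b N K \<eta>"
    and spectral: "spectral_factorization N (gram_matrix a b N \<eta>) U lam"
    and lam_pos: "\<And>l. l < N \<Longrightarrow> lam l > 0"
    and v_eq: "\<And>l. l < N \<Longrightarrow> v l = (\<lambda>t. \<Sum>j<N. U $$ (j, l) / sqrt (lam l) * \<eta> j t)"
begin

lemma eta_W: "j < N \<Longrightarrow> \<eta> j \<in> W a b"
  and K_index: "j < N \<Longrightarrow> f \<in> W a b \<Longrightarrow> K f $ j = W_inner a b (\<eta> j) f"
  using riesz by (auto simp: riesz_representers_def)

lemma v_W: "l < N \<Longrightarrow> v l \<in> W a b"
  by (simp only: v_eq, rule W_sum[OF less eta_W])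

section \<open>Orthonormal columns of U as eigenvectors of the Gram matrix\<close>

lemma U_carrier: "U \<in> carrier_mat N N"
  using spectral by (simp add: spectral_factorization_def)

lemma col_U: "col U l \<in> carrier_vec N" "i < N \<Longrightarrow> l < N \<Longrightarrow> col U l $ i = U $$ (i, l)"
  using U_carrier by (auto simp: col_def)

lemma scalar_prod_col_U:
  "l < N \<Longrightarrow> y \<in> carrier_vec N \<Longrightarrow> col U l \<bullet> y = (\<Sum>j<N. U $$ (j, l) * y $ j)"
  unfolding scalar_prod_def lessThan_atLeast0 by (auto simp: col_U intro!: sum.cong)

lemma col_U_orthonormal:
  assumes "k < N" "l < N"
  shows "col U k \<bullet> col U l = (if k = l then 1 else 0)"
proof -
  have "col U k \<bullet> col U l = (U\<^sup>T * U) $$ (k, l)" using assms U_carrier by simp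
  then show ?thesis using assms spectral by (simp add: spectral_factorization_def)
qed

lemma U_rows_orthonormal:
  assumes "i < N" "j < N"
  shows "(\<Sum>l<N. U $$ (i, l) * U $$ (j, l)) = (if i = j then 1 else 0)"
proof -
  have "(U * U\<^sup>T) $$ (i, j) = (\<Sum>l<N. U $$ (i, l) * U $$ (j, l))"
    using assms U_carrier unfolding lessThan_atLeast0 by (auto simp: scalar_prod_def intro!: sum.cong)
  then show ?thesis using assms spectral by (simp add: spectral_factorization_def)
qed

text \<open>Completeness of the columns: after exchanging the sums, orthonormality of the rows
  collapses the inner sum to a Kronecker delta.\<close>

lemma col_U_expansion:
  assumes y: "y \<in> carrier_vec N" and "i < N"
  shows "(\<Sum>l<N. (col U l \<bullet> y) * U $$ (i, l)) = y $ i"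
proof -
  have "(\<Sum>l<N. (col U l \<bullet> y) * U $$ (i, l)) = (\<Sum>l<N. \<Sum>j<N. U $$ (j, l) * y $ j * U $$ (i, l))"
    using y by (intro sum.cong refl) (simp add: scalar_prod_col_U sum_distrib_right)
  also have "\<dots> = (\<Sum>j<N. \<Sum>l<N. U $$ (j, l) * y $ j * U $$ (i, l))" by (rule sum.swap)
  also have "\<dots> = (\<Sum>j<N. y $ j * (\<Sum>l<N. U $$ (i, l) * U $$ (j, l)))"
    by (simp add: sum_distrib_left mult_ac)
  also have "\<dots> = (\<Sum>j<N. y $ j * (if i = j then 1 else 0))"
    using U_rows_orthonormal[OF \<open>i < N\<close>] by (intro sum.cong refl) simp
  also have "\<dots> = y $ i" using \<open>i < N\<close> by (simp add: if_distrib cong: if_cong)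
  finally show ?thesis .
qed

text \<open>Multiplying the factorization by \<open>U\<close> from the right cancels the transpose;
  the claim is the entry (i, l) of the resulting identity.\<close>

lemma gram_eigenvector:
  assumes "i < N" "l < N"
  shows "(\<Sum>j<N. W_inner a b (\<eta> i) (\<eta> j) * U $$ (j, l)) = lam l * U $$ (i, l)"
proof -
  let ?G = "gram_matrix a b N \<eta>"
  have D: "mat_diag N lam \<in> carrier_mat N N" by simp
  have T: "U\<^sup>T \<in> carrier_mat N N" using U_carrier by simp
  have "?G * U = U * mat_diag N lam * U\<^sup>T * U"
    using spectral by (simp add: spectral_factorization_def)
  also have "\<dots> = U * mat_diag N lam * (U\<^sup>T * U)"
    by (rule assoc_mult_mat[OF mult_carrier_mat[OF U_carrier D] T U_carrier])
  also have "\<dots> = U * mat_diag N lam"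
    using spectral right_mult_one_mat[OF mult_carrier_mat[OF U_carrier D]]
    by (simp add: spectral_factorization_def)
  finally have "(?G * U) $$ (i, l) = (U * mat_diag N lam) $$ (i, l)" by simp
  also have "\<dots> = lam l * U $$ (i, l)"
    using assms U_carrier by (simp add: mat_diag_mult_right[OF U_carrier])
  also have "(?G * U) $$ (i, l) = (\<Sum>j<N. W_inner a b (\<eta> i) (\<eta> j) * U $$ (j, l))"
    using assms U_carrier unfolding lessThan_atLeast0
    by (auto simp: gram_matrix_def scalar_prod_def intro!: sum.cong)
  finally show ?thesis .
qed

section \<open>The functions \<open>v l\<close> and the action of \<open>K\<close> on them\<close>

lemma W_inner_v:
  assumes "l < N" "f \<in> W a b"
  shows "W_inner a b (v l) f = (col U l \<bullet> K f) / sqrt (lam l)"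
proof -
  have "W_inner a b (v l) f = (\<Sum>j<N. U $$ (j, l) / sqrt (lam l) * W_inner a b (\<eta> j) f)"
    unfolding v_eq[OF assms(1)] by (rule W_inner_sum_left[OF less eta_W assms(2)])
  also have "\<dots> = (\<Sum>j<N. U $$ (j, l) * K f $ j) / sqrt (lam l)"
    using assms(2) by (simp add: sum_divide_distrib K_index)
  finally show ?thesis using assms(1) by (simp add: scalar_prod_col_U K_carrier)
qed

text \<open>Pairing \<open>v l\<close> with \<open>\<eta> i\<close> produces the \<open>i\<close>th
  entry of the Gram matrix applied to the eigenvector, divided by the root of the
  eigenvalue.\<close>

lemma K_v:
  assumes "l < N"
  shows "K (v l) = sqrt (lam l) \<cdot>\<^sub>v col U l"
proof (rule eq_vecI)
  show "dim_vec (K (v l)) = dim_vec (sqrt (lam l) \<cdot>\<^sub>v col U l)"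
    using K_carrier[of "v l"] U_carrier by simp
  fix i assume "i < dim_vec (sqrt (lam l) \<cdot>\<^sub>v col U l)"
  then have i: "i < N" using U_carrier by simp
  have "K (v l) $ i = W_inner a b (v l) (\<eta> i)"
    using K_index[OF i v_W[OF assms]] by (simp add: W_inner_commute)
  also have "\<dots> = (\<Sum>j<N. U $$ (j, l) / sqrt (lam l) * W_inner a b (\<eta> j) (\<eta> i))"
    unfolding v_eq[OF assms] by (rule W_inner_sum_left[OF less eta_W eta_W[OF i]])
  also have "\<dots> = (\<Sum>j<N. W_inner a b (\<eta> i) (\<eta> j) * U $$ (j, l)) / sqrt (lam l)"
    by (simp add: sum_divide_distrib W_inner_commute mult.commute)
  also have "\<dots> = sqrt (lam l) * U $$ (i, l)"
    unfolding gram_eigenvector[OF i assms] using real_div_sqrt[of "lam l"] lam_pos[OF assms]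
    by (simp add: times_divide_eq_left[symmetric] del: times_divide_eq_left)
  finally show "K (v l) $ i = (sqrt (lam l) \<cdot>\<^sub>v col U l) $ i"
    using i assms U_carrier by simp
qed

lemma v_orthonormal: "orthonormal_W a b N v"
  unfolding orthonormal_W_def
proof (intro conjI allI impI)
  fix k l assume kl: "k < N" "l < N"
  have "W_inner a b (v k) (v l) = (col U k \<bullet> (sqrt (lam l) \<cdot>\<^sub>v col U l)) / sqrt (lam k)"
    using W_inner_v[OF kl(1) v_W[OF kl(2)]] K_v[OF kl(2)] by simp
  also have "\<dots> = sqrt (lam l) * (col U k \<bullet> col U l) / sqrt (lam k)"
    using scalar_prod_smult_distrib[OF col_U(1) col_U(1)] by simp
  finally show "W_inner a b (v k) (v l) = (if k = l then 1 else 0)"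
    using col_U_orthonormal[OF kl] lam_pos[OF kl(1)] by (cases "k = l") auto
qed (rule v_W)

lemma comb_W: "(\<lambda>t. \<Sum>l<N. c l * v l t) \<in> W a b"
  by (rule W_sum[OF less v_W])

lemma K_comb:
  assumes "i < N"
  shows "K (\<lambda>t. \<Sum>l<N. c l * v l t) $ i = (\<Sum>l<N. c l * sqrt (lam l) * U $$ (i, l))"
proof -
  have "K (\<lambda>t. \<Sum>l<N. c l * v l t) $ i = W_inner a b (\<lambda>t. \<Sum>l<N. c l * v l t) (\<eta> i)"
    using K_index[OF assms comb_W] by (simp add: W_inner_commute)
  also have "\<dots> = (\<Sum>l<N. c l * W_inner a b (v l) (\<eta> i))"
    by (rule W_inner_sum_left[OF less v_W eta_W[OF assms]])
  also have "\<dots> = (\<Sum>l<N. c l * sqrt (lam l) * U $$ (i, l))"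
  proof (rule sum.cong[OF refl])
    fix l assume "l \<in> {..<N}"
    then have l: "l < N" by simp
    have "W_inner a b (v l) (\<eta> i) = K (v l) $ i"
      using K_index[OF assms v_W[OF l]] by (simp add: W_inner_commute)
    then show "c l * W_inner a b (v l) (\<eta> i) = c l * sqrt (lam l) * U $$ (i, l)"
      using K_v[OF l] assms l U_carrier by simp
  qed
  finally show ?thesis .
qed

text \<open>Up to the positive factors sqrt(lam l), the inner products with the \<open>v l\<close>
  are the coordinates of \<open>K f\<close> in the basis of columns of \<open>U\<close>.\<close>

lemma K_eq_zero_iff:
  assumes "f \<in> W a b"
  shows "K f = 0\<^sub>v N \<longleftrightarrow> (\<forall>l<N. W_inner a b (v l) f = 0)"
proof
  assume "K f = 0\<^sub>v N"
  then show "\<forall>l<N. W_inner a b (v l) f = 0"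
    using assms by (simp add: W_inner_v scalar_prod_right_zero[OF col_U(1)])
next
  assume *: "\<forall>l<N. W_inner a b (v l) f = 0"
  have "col U l \<bullet> K f = 0" if "l < N" for l
    using * that lam_pos[OF that] W_inner_v[OF that assms] by simp
  then have "K f $ i = 0" if "i < N" for i
    using col_U_expansion[OF K_carrier that, of f] by simp
  then show "K f = 0\<^sub>v N" using K_carrier[of f] by (intro eq_vecI) auto
qed

lemma W_inner_comb_eq_zero:
  assumes "f \<in> W a b" "K f = 0\<^sub>v N"
  shows "W_inner a b (\<lambda>t. \<Sum>l<N. c l * v l t) f = 0"
proof -
  have "W_inner a b (\<lambda>t. \<Sum>l<N. c l * v l t) f = (\<Sum>l<N. c l * W_inner a b (v l) f)"
    by (rule W_inner_sum_left[OF less v_W assms(1)])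
  then show ?thesis using K_eq_zero_iff[OF assms(1)] assms(2) by simp
qed

text \<open>The remainder \<open>h\<close> of the Fourier expansion is orthogonal to every
  \<open>v k\<close>, hence lies in the null space. Both \<open>f\<close> and its expansion
  \<open>s\<close> are orthogonal to the null space, so \<open>h\<close> is orthogonal to
  itself.\<close>

lemma null_space_perp_expansion:
  assumes "f \<in> null_space_perp a b N K"
  shows "f = (\<lambda>t. \<Sum>l<N. W_inner a b (v l) f * v l t)"
proof -
  define s where "s = (\<lambda>t. \<Sum>l<N. W_inner a b (v l) f * v l t)"
  define h where "h = (\<lambda>t. 1 * f t + (-1) * s t)"
  have f: "f \<in> W a b" using assms by (simp add: null_space_perp_def)
  have s: "s \<in> W a b" unfolding s_def by (rule comb_W)
  have h: "h \<in> W a b" unfolding h_def by (rule W_lincomb[OF less f s])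
  have hl: "W_inner a b h g = W_inner a b f g - W_inner a b s g" if "g \<in> W a b" for g
    unfolding h_def using W_inner_lincomb_left[OF less f s that, of 1 "-1"] by simp
  have "W_inner a b (v k) h = 0" if k: "k < N" for k
  proof -
    have "W_inner a b s (v k) = (\<Sum>l<N. W_inner a b (v l) f * W_inner a b (v l) (v k))"
      unfolding s_def by (rule W_inner_sum_left[OF less v_W v_W[OF k]])
    also have "\<dots> = (\<Sum>l<N. W_inner a b (v l) f * (if l = k then 1 else 0))"
      using v_orthonormal k by (intro sum.cong refl) (simp add: orthonormal_W_def)
    also have "\<dots> = W_inner a b (v k) f" using k by (simp add: if_distrib cong: if_cong)
    finally show ?thesis using hl[OF v_W[OF k]] by (simp add: W_inner_commute)
  qed
  then have Kh: "K h = 0\<^sub>v N" using K_eq_zero_iff[OF h] by simp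
  have "W_inner a b h h = 0"
    using hl[OF h] assms h Kh W_inner_comb_eq_zero[OF h Kh] by (simp add: null_space_perp_def s_def)
  then have "h = (\<lambda>_. 0)" by (rule W_inner_definite[OF less h])
  then have "f t = s t" for t by (auto simp: h_def fun_eq_iff)
  then show ?thesis unfolding s_def by blast
qed

section \<open>The adjoint and the singular system\<close>

lemma adjoint_col_U:
  assumes "l < N"
  shows "adjoint_op a b K (col U l) = (\<lambda>t. sqrt (lam l) * v l t)"
proof -
  let ?u = "\<lambda>t. sqrt (lam l) * v l t"
  have u: "?u \<in> W a b" using W_lincomb[OF less v_W v_W, OF assms assms, of "sqrt (lam l)" 0] by simp
  have ui: "K f \<bullet> col U l = W_inner a b f ?u" if f: "f \<in> W a b" for f
  proof -
    have "W_inner a b ?u f = sqrt (lam l) * W_inner a b (v l) f"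
      using W_inner_lincomb_left[OF less v_W[OF assms] v_W[OF assms] f, of "sqrt (lam l)" 0] by simp
    also have "\<dots> = col U l \<bullet> K f" using W_inner_v[OF assms f] lam_pos[OF assms] by simp
    finally show ?thesis
      using comm_scalar_prod[OF K_carrier col_U(1)] by (simp add: W_inner_commute)
  qed
  show ?thesis
    unfolding adjoint_op_def
  proof (rule the_equality)
    show "?u \<in> W a b \<and> (\<forall>f\<in>W a b. K f \<bullet> col U l = W_inner a b f ?u)" using u ui by blast
    \<comment> \<open>Uniqueness, required by the definite description: two representing elements
      have the same inner product with their difference \<open>h\<close>, so \<open>h\<close> has
      norm zero.\<close>
    fix w assume w: "w \<in> W a b \<and> (\<forall>f\<in>W a b. K f \<bullet> col U l = W_inner a b f w)"
    define h where "h = (\<lambda>t. 1 * w t + (-1) * ?u t)"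
    have h: "h \<in> W a b" unfolding h_def using W_lincomb[OF less _ u] w by blast
    have "W_inner a b h h = W_inner a b w h - W_inner a b ?u h"
      using W_inner_lincomb_left[OF less _ u h, of w 1 "-1"] w by (simp add: h_def)
    also have "\<dots> = 0" using w ui[OF h] h by (metis W_inner_commute diff_self)
    finally have "h = (\<lambda>_. 0)" by (rule W_inner_definite[OF less h])
    then have "w t = ?u t" for t by (auto simp: h_def fun_eq_iff)
    then show "w = ?u" by blast
  qed
qed

lemma singular_system: "singular_system a b N K N (\<lambda>l. sqrt (lam l)) v (col U)"
  unfolding singular_system_def
proof (intro conjI allI impI)
  show "0 < sqrt (lam l)" if "l < N" for l using lam_pos[OF that] by simp
  show "sqrt (lam l) \<le> sqrt (lam k)" if "k \<le> l \<and> l < N" for k l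
    using spectral that by (simp add: spectral_factorization_def)
  show "orthonormal_basis_W a b N v (null_space_perp a b N K)"
    unfolding orthonormal_basis_W_def
  proof (intro conjI allI impI ballI v_orthonormal)
    show "v l \<in> null_space_perp a b N K" if "l < N" for l
      using v_W[OF that] K_eq_zero_iff that by (auto simp: null_space_perp_def)
    show "\<exists>c. f = (\<lambda>t. \<Sum>l<N. c l * v l t)" if "f \<in> null_space_perp a b N K" for f
      by (rule exI[of _ "\<lambda>l. W_inner a b (v l) f"], rule null_space_perp_expansion[OF that])
  qed
  show "orthonormal_basis_vec N N (col U) (K ` W a b)"
    unfolding orthonormal_basis_vec_def
  proof (intro conjI allI impI ballI)
    show "col U l \<in> carrier_vec N" for l by (rule col_U(1))
    show "col U l \<in> K ` W a b" if l: "l < N" for l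
    proof (rule image_eqI)
      \<comment> \<open>The preimage of \<open>col U l\<close> is \<open>v l\<close> divided by its
        singular value, written as a full combination with one nonzero coefficient so that
        \<open>K_comb\<close> applies.\<close>
      let ?c = "\<lambda>k. if k = l then 1 / sqrt (lam l) else 0 :: real"
      show "(\<lambda>t. \<Sum>k<N. ?c k * v k t) \<in> W a b" by (rule comb_W)
      show "col U l = K (\<lambda>t. \<Sum>k<N. ?c k * v k t)"
      proof (rule eq_vecI)
        show "dim_vec (col U l) = dim_vec (K (\<lambda>t. \<Sum>k<N. ?c k * v k t))"
          unfolding carrier_vecD[OF K_carrier] using U_carrier by simp
        fix i assume "i < dim_vec (K (\<lambda>t. \<Sum>k<N. ?c k * v k t))"
        then have i: "i < N" unfolding carrier_vecD[OF K_carrier] .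
        have "K (\<lambda>t. \<Sum>k<N. ?c k * v k t) $ i = (\<Sum>k<N. if k = l then U $$ (i, l) else 0)"
          unfolding K_comb[OF i] using lam_pos[OF l] by (intro sum.cong refl) simp
        also have "\<dots> = col U l $ i" using l i col_U(2) by simp
        finally show "col U l $ i = K (\<lambda>t. \<Sum>k<N. ?c k * v k t) $ i" by simp
      qed
    qed
    show "col U k \<bullet> col U l = (if k = l then 1 else 0)" if "k < N" "l < N" for k l
      using col_U_orthonormal[OF that] .
    fix y assume "y \<in> K ` W a b"
    then have y: "y \<in> carrier_vec N" using K_carrier by auto
    \<comment> \<open>The Fourier coefficients of \<open>y\<close> serve; only its dimension
      matters, since the columns span all of R^N.\<close>
    show "\<exists>c. y = Matrix.vec N (\<lambda>j. \<Sum>l<N. c l * col U l $ j)"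
      using y col_U_expansion[OF y] col_U(2)
      by (intro exI[of _ "\<lambda>l. col U l \<bullet> y"] eq_vecI) auto
  qed
  show "K (v l) = sqrt (lam l) \<cdot>\<^sub>v col U l" if "l < N" for l by (rule K_v[OF that])
  show "adjoint_op a b K (col U l) = (\<lambda>t. sqrt (lam l) * v l t)" if "l < N" for l
    by (rule adjoint_col_U[OF that])
qed

text \<open>The candidate \<open>s\<close> solves the equation exactly, so the least residual is
  zero and the minimizers are the exact solutions. Any of them is \<open>s\<close> plus an
  orthogonal null space element, which makes the norm strictly larger unless it vanishes.\<close>

lemma minimal_norm_solution_iff:
  assumes y: "y \<in> carrier_vec N" and c: "\<And>l. l < N \<Longrightarrow> c l = (col U l \<bullet> y) / sqrt (lam l)"
  shows "is_minimal_norm_solution a b K y f \<longleftrightarrow> f = (\<lambda>t. \<Sum>l<N. c l * v l t)"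
proof -
  define s where "s = (\<lambda>t. \<Sum>l<N. c l * v l t)"
  have s: "s \<in> W a b" unfolding s_def by (rule comb_W)
  have Ks: "K s = y"
  proof (rule eq_vecI)
    show "dim_vec (K s) = dim_vec y" unfolding carrier_vecD[OF K_carrier] using y by simp
    fix i assume "i < dim_vec y"
    then have i: "i < N" using y by simp
    have "K s $ i = (\<Sum>l<N. (col U l \<bullet> y) * U $$ (i, l))"
      unfolding s_def K_comb[OF i] using c by (intro sum.cong refl) (simp add: less_imp_neq[OF lam_pos, symmetric])
    then show "K s $ i = y $ i" using col_U_expansion[OF y i] by simp
  qed
  have sq: "(vec_norm2 w)\<^sup>2 = w \<bullet> w" for w
    by (simp add: vec_norm2_def scalar_prod_def sum_nonneg)
  have definite: "w \<bullet> w \<le> 0 \<longleftrightarrow> (\<forall>i<N. w $ i = 0)" if "w \<in> carrier_vec N" for w :: "real vec"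
  proof -
    have "w \<bullet> w = (\<Sum>i<N. w $ i * w $ i)"
      using that by (simp add: scalar_prod_def lessThan_atLeast0)
    moreover have "(\<Sum>i<N. w $ i * w $ i) \<ge> 0" by (intro sum_nonneg) simp
    ultimately have "w \<bullet> w \<le> 0 \<longleftrightarrow> (\<Sum>i<N. w $ i * w $ i) = 0" by linarith
    also have "\<dots> \<longleftrightarrow> (\<forall>i<N. w $ i = 0)" by (subst sum_nonneg_eq_0_iff) auto
    finally show ?thesis .
  qed
  \<comment> \<open>The form with \<open>\<le> 0\<close> combines directly with the comparison of a
    minimizer against \<open>s\<close>.\<close>
  have residual: "(vec_norm2 (K h - y))\<^sup>2 \<le> 0 \<longleftrightarrow> K h = y" for h
  proof -
    have "K h - y \<in> carrier_vec N" using K_carrier[of h] y by simp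
    then have "(vec_norm2 (K h - y))\<^sup>2 \<le> 0 \<longleftrightarrow> (\<forall>i<N. (K h - y) $ i = 0)"
      unfolding sq by (rule definite)
    also have "\<dots> \<longleftrightarrow> K h = y"
      using K_carrier[of h] y by (auto intro!: eq_vecI)
    finally show ?thesis .
  qed
  have ls: "least_squares_minimizer a b K y h \<longleftrightarrow> h \<in> W a b \<and> K h = y" for h
  proof
    assume "least_squares_minimizer a b K y h"
    then have h: "h \<in> W a b" and "(vec_norm2 (K h - y))\<^sup>2 \<le> (vec_norm2 (K s - y))\<^sup>2"
      using s by (auto simp: least_squares_minimizer_def)
    moreover have "(vec_norm2 (K s - y))\<^sup>2 \<le> 0" using residual Ks by blast
    ultimately show "h \<in> W a b \<and> K h = y" using residual by (meson order_trans)
  next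
    assume h: "h \<in> W a b \<and> K h = y"
    then have "(vec_norm2 (K h - y))\<^sup>2 \<le> 0" using residual[of h] by blast
    then have "(vec_norm2 (K h - y))\<^sup>2 \<le> (vec_norm2 (K h' - y))\<^sup>2" for h'
      by (rule order_trans) (rule zero_le_power2)
    then show "least_squares_minimizer a b K y h"
      using h by (simp add: least_squares_minimizer_def)
  qed
  \<comment> \<open>The difference \<open>d\<close> of two solutions is in the null space, hence
    orthogonal to \<open>s\<close>, which is a combination of the \<open>v l\<close>.\<close>
  have pyth: "\<exists>d\<in>W a b. W_inner a b h h = W_inner a b s s + W_inner a b d d \<and> (\<forall>t. h t = s t + d t)"
    if h: "h \<in> W a b" "K h = y" for h
  proof -
    define d where "d = (\<lambda>t. 1 * h t + (-1) * s t)"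
    have d: "d \<in> W a b" unfolding d_def by (rule W_lincomb[OF less h(1) s])
    have dl: "W_inner a b d g = W_inner a b h g - W_inner a b s g" if "g \<in> W a b" for g
      unfolding d_def using W_inner_lincomb_left[OF less h(1) s that, of 1 "-1"] by simp
    have "K d $ i = 0" if i: "i < N" for i
    proof -
      have "K d $ i = K h $ i - K s $ i"
        using dl[OF eta_W[OF i]] K_index[OF i] d h(1) s by (simp add: W_inner_commute)
      then show ?thesis using Ks h(2) by simp
    qed
    then have Kd: "K d = 0\<^sub>v N" using K_carrier[of d] by (intro eq_vecI) auto
    have sd: "W_inner a b s d = 0" unfolding s_def by (rule W_inner_comb_eq_zero[OF d Kd])
    have "W_inner a b d d = W_inner a b h d" using dl[OF d] sd by simp
    moreover have "W_inner a b h d = W_inner a b h h - W_inner a b h s"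
      using dl[OF h(1)] by (simp add: W_inner_commute)
    moreover have "W_inner a b h s = W_inner a b s s"
      using dl[OF s] sd by (simp add: W_inner_commute)
    ultimately have "W_inner a b h h = W_inner a b s s + W_inner a b d d" by simp
    then show ?thesis using d by (auto simp: d_def)
  qed
  have "is_minimal_norm_solution a b K y s"
    unfolding is_minimal_norm_solution_def ls
  proof (intro conjI allI impI s Ks)
    fix h assume "h \<in> W a b \<and> K h = y"
    then obtain d where "W_inner a b h h = W_inner a b s s + W_inner a b d d" using pyth by blast
    then show "W_norm a b s \<le> W_norm a b h"
      using W_inner_nonneg[of a b d] by (simp add: W_norm_def)
  qed
  moreover have "h = s" if "is_minimal_norm_solution a b K y h" for h
  proof -
    have h: "h \<in> W a b" "K h = y" and le: "W_norm a b h \<le> W_norm a b s"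
      using that s Ks unfolding is_minimal_norm_solution_def ls by auto
    obtain d where d: "d \<in> W a b" "W_inner a b h h = W_inner a b s s + W_inner a b d d"
      "\<And>t. h t = s t + d t" using pyth[OF h] by blast
    \<comment> \<open>Minimality bounds the norm of \<open>h\<close> by that of \<open>s\<close>, so
      the Pythagorean surplus is at most zero.\<close>
    have "W_inner a b d d = 0"
      using le d(2) W_inner_nonneg[of a b d] by (simp add: W_norm_def)
    then have "d = (\<lambda>_. 0)" by (rule W_inner_definite[OF less d(1)])
    then show ?thesis using d(3) by auto
  qed
  ultimately show ?thesis unfolding s_def by blast
qed

end

theorem theorem4p1:
  fixes a b :: real and m N :: nat and n :: "nat \<Rightarrow> nat"
    and c d :: "nat \<Rightarrow> real" and k :: "nat \<Rightarrow> real \<Rightarrow> real \<Rightarrow> real"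
    and x :: "nat \<Rightarrow> nat \<Rightarrow> real" and g :: "nat \<Rightarrow> real \<Rightarrow> real"
    and K :: "(real \<Rightarrow> real) \<Rightarrow> real vec" and gv :: "real vec"
    and \<eta> eta_hat :: "nat \<Rightarrow> real \<Rightarrow> real" and c_hat lam :: "nat \<Rightarrow> real" and U :: "real mat"
  assumes "a < b" and "m \<ge> 1" and "\<forall>r\<in>{1..m}. n r \<ge> 1"
    and "N = block_offset n m"
    and "\<forall>r\<in>{1..m}. \<forall>i\<in>{1..n r}. x r i \<in> {c r..d r}"
    and "K = K_op a b m n k x"
    and "K_well_defined a b m n k x" and "bounded_linear_on_W a b K"
    and "gv = block_vec m n (\<lambda>r i. g r (x r i))"
    and "riesz_representers a b N K \<eta>"
    and "positive_definite N (gram_matrix a b N \<eta>)"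
    and "spectral_factorization N (gram_matrix a b N \<eta>) U lam" and "\<forall>l<N. lam l > 0"
    and "\<forall>l<N. c_hat l = (col U l \<bullet> gv) / sqrt (lam l)"
    and "\<forall>l<N. eta_hat l = (\<lambda>t. \<Sum>j<N. U $$ (j, l) / sqrt (lam l) * \<eta> j t)"
  shows "orthonormal_W a b N eta_hat \<and>
    (\<exists>!f. is_minimal_norm_solution a b K gv f) \<and>
    minimal_norm_solution a b K gv = (\<lambda>t. \<Sum>l<N. c_hat l * eta_hat l t) \<and>
    singular_system a b N K N (\<lambda>l. sqrt (lam l)) eta_hat (col U)"
proof -
  \<comment> \<open>The dimension assumption holds for every argument of \<open>K\<close>, as the
    length of a block vector does not depend on its entries.\<close>
  interpret gram_spectral_system a b N K \<eta> eta_hat U lam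
    by unfold_locales (use assms block_vec_carrier in \<open>auto simp: K_op_def\<close>)
  have "gv \<in> carrier_vec N" using assms(4,9) block_vec_carrier by simp
  \<comment> \<open>An equivalence with an equation gives existence, uniqueness and the value of the
    definite description at once.\<close>
  then have "is_minimal_norm_solution a b K gv f \<longleftrightarrow> f = (\<lambda>t. \<Sum>l<N. c_hat l * eta_hat l t)" for f
    using assms(14) by (intro minimal_norm_solution_iff) auto
  then show ?thesis
    using v_orthonormal singular_system by (simp add: minimal_norm_solution_def)
qed

end
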